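(* Let $\Omega,\lambda,\alpha>0$. Then the folded sampling operator $$\mathcal{M}_{\lambda,\alpha\mathbb{Z}}: PW_\Omega(\mathbb{R})\to \ell^2_\lambda(\mathbb{Z}),\qquad f\mapsto \mathcal{M}_{\lambda,\alpha\mathbb{Z}}f=(\mathcal{M}_\lambda f(\alpha k))_{k\in\mathbb{Z}},$$ does not admit a left-inverse $\mathcal{T}_{\lambda,\alpha\mathbb{Z}}:\mathrm{Range}(\mathcal{M}_{\lambda,\alpha\mathbb{Z}})\to PW_\Omega(\mathbb{R})$ that is continuous at any point of its domain (with the distance of $\ell^2_\lambda(\mathbb{Z})$ on the range and the $L^2(\mathbb{R})$-norm on $PW_\Omega(\mathbb{R})$). More concretely, for every $f\in PW_\Omega(\mathbb{R})$ there exists $\varepsilon>0$ such that for every $\delta>0$ there exists $g\in PW_\Omega(\mathbb{R})$ with $$\|\mathcal{M}_{\lambda,\alpha\mathbb{Z}}f-\mathcal{M}_{\lambda,\alpha\mathbb{Z}}g\|_{\ell^2_\lambda(\mathbb{Z})}<\delta\quad\text{but}\quad \|f-g\|_{L^2(\mathbb{R})}>\varepsilon.$$ The statement remains true if the operator is restricted to the real-valued functions in $PW_\Omega(\mathbb{R})$ (that is, with $f$ and $g$ both real-valued).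
   Context: Fourier transform: $\hat f(\xi)=\int_{\mathbb{R}}f(t)e^{-2\pi i t\xi}\,dt$. The Paley-Wiener space is $PW_\Omega(\mathbb{R})=\{f\in L^2(\mathbb{R}):\hat f=0\text{ a.e. outside }[-\Omega/2,\Omega/2]\}$ with the $L^2(\mathbb{R})$-norm; its (complex-valued) elements are identified with their continuous representatives, so point values make sense. Folding: for real $x$, $\mathcal{M}_\lambda(x)$ is the unique number in $[-\lambda,\lambda)$ with $x-\mathcal{M}_\lambda(x)\in 2\lambda\mathbb{Z}$; for complex numbers, $\mathcal{M}_\lambda(x+iy)=\mathcal{M}_\lambda(x)+i\mathcal{M}_\lambda(y)$. Toral (semi-)metric: $|z-w|_\lambda=\inf_{n\in\mathbb{Z}+i\mathbb{Z}}|z-w-2\lambda n|$ for $z,w\in\mathbb{C}$. The space $\ell^2_\lambda(\mathbb{Z})=\{a\in\ell^2(\mathbb{Z}): a_k\in[-\lambda,\lambda)+i[-\lambda,\lambda)\ \forall k\}$ carries the distance $\|a-b\|_{\ell^2_\lambda(\mathbb{Z})}=\big(\sum_{k\in\mathbb{Z}}|a_k-b_k|_\lambda^2\big)^{1/2}$. A left-inverse of $\mathcal{M}_{\lambda,\alpha\mathbb{Z}}$ is a map $\mathcal{T}$ on its range with $\mathcal{T}\mathcal{M}_{\lambda,\alpha\mathbb{Z}}f=f$ for all $f$ in the domain. *)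

theory Defs
  imports "HOL-Analysis.Analysis"
begin

definition square_integrable :: "(real \<Rightarrow> complex) \<Rightarrow> bool" where
  "square_integrable f \<longleftrightarrow>
     f \<in> borel_measurable lborel \<and> integrable lborel (\<lambda>t. (cmod (f t))\<^sup>2)"

definition L2_norm :: "(real \<Rightarrow> complex) \<Rightarrow> real" where
  "L2_norm f = sqrt (LINT t|lborel. (cmod (f t))\<^sup>2)"

definition fourier_integral :: "(real \<Rightarrow> complex) \<Rightarrow> real \<Rightarrow> complex" where
  "fourier_integral f \<xi> = (LINT t|lborel. f t * exp (- 2 * pi * \<i> * t * \<xi>))"

text \<open>
  The integral defining the Fourier transform need not converge for a square-integrable \<open>f\<close>.
  As usual, the transform of \<open>f\<close> is the (a.e. unique) \<open>F\<close> that is the limit in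
  mean square of the Fourier integrals of the truncations of \<open>f\<close>. The mean-square error is a
  nonnegative extended real, so that no default value of the integral can intervene.
\<close>

definition has_fourier_transform :: "(real \<Rightarrow> complex) \<Rightarrow> (real \<Rightarrow> complex) \<Rightarrow> bool" where
  "has_fourier_transform f F \<longleftrightarrow>
     square_integrable f \<and> square_integrable F \<and>
     ((\<lambda>R. \<integral>\<^sup>+ \<xi>. ennreal ((cmod (fourier_integral (\<lambda>t. indicator {-R..R} t * f t) \<xi> - F \<xi>))\<^sup>2) \<partial>lborel)
        \<longlongrightarrow> 0) at_top"

text \<open>
  The elements are the continuous representatives, hence actual functions rather than
  classes modulo a.e. equality.
\<close>

definition PW :: "real \<Rightarrow> (real \<Rightarrow> complex) set" where
  "PW \<Omega> = {f. continuous_on UNIV f \<and> square_integrable f \<and>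
     (\<exists>F. has_fourier_transform f F \<and>
          (AE \<xi> in lborel. \<xi> \<notin> {-\<Omega>/2..\<Omega>/2} \<longrightarrow> F \<xi> = 0))}"

definition PW_real :: "real \<Rightarrow> (real \<Rightarrow> complex) set" where
  "PW_real \<Omega> = {f \<in> PW \<Omega>. \<forall>t. f t \<in> \<real>}"

definition fold_real :: "real \<Rightarrow> real \<Rightarrow> real" where
  "fold_real lam x = (THE y. y \<in> {-lam..<lam} \<and> (\<exists>n::int. x - y = 2 * lam * of_int n))"

definition fold_complex :: "real \<Rightarrow> complex \<Rightarrow> complex" where
  "fold_complex lam z = Complex (fold_real lam (Re z)) (fold_real lam (Im z))"

definition toral_dist :: "real \<Rightarrow> complex \<Rightarrow> complex \<Rightarrow> real" where
  "toral_dist lam z w =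
     (INF (p, q) \<in> (UNIV :: (int \<times> int) set).
        cmod (z - w - 2 * of_real lam * Complex (of_int p) (of_int q)))"

definition ell2_mod :: "real \<Rightarrow> (int \<Rightarrow> complex) set" where
  "ell2_mod lam = {a. (\<lambda>k. (cmod (a k))\<^sup>2) summable_on UNIV \<and>
     (\<forall>k. Re (a k) \<in> {-lam..<lam} \<and> Im (a k) \<in> {-lam..<lam})}"

text \<open>
  On \<^term>\<open>ell2_mod lam\<close> the sum always converges, since the toral distance of \<open>a k\<close> and
  \<open>b k\<close> is at most \<open>cmod (a k - b k)\<close>.
\<close>

definition ell2_mod_dist :: "real \<Rightarrow> (int \<Rightarrow> complex) \<Rightarrow> (int \<Rightarrow> complex) \<Rightarrow> real" where
  "ell2_mod_dist lam a b = sqrt (\<Sum>\<^sub>\<infinity>k\<in>UNIV. (toral_dist lam (a k) (b k))\<^sup>2)"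

definition folded_sampling :: "real \<Rightarrow> real \<Rightarrow> (real \<Rightarrow> complex) \<Rightarrow> int \<Rightarrow> complex" where
  "folded_sampling lam \<alpha> f k = fold_complex lam (f (\<alpha> * of_int k))"

definition left_inverse_on ::
  "(real \<Rightarrow> complex) set \<Rightarrow> ((real \<Rightarrow> complex) \<Rightarrow> int \<Rightarrow> complex) \<Rightarrow>
   ((int \<Rightarrow> complex) \<Rightarrow> real \<Rightarrow> complex) \<Rightarrow> bool" where
  "left_inverse_on D M T \<longleftrightarrow> T \<in> M ` D \<rightarrow> D \<and> (\<forall>f\<in>D. T (M f) = f)"

text \<open>
  Continuity at \<open>a\<close> of \<open>T\<close>, regarded as a map with domain \<open>S\<close>, from the distance of
  \<^term>\<open>ell2_mod lam\<close> to the \<open>L\<^sup>2\<close>-norm.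
\<close>

definition recovery_continuous_at ::
  "real \<Rightarrow> (int \<Rightarrow> complex) set \<Rightarrow> ((int \<Rightarrow> complex) \<Rightarrow> real \<Rightarrow> complex) \<Rightarrow>
   (int \<Rightarrow> complex) \<Rightarrow> bool" where
  "recovery_continuous_at lam S T a \<longleftrightarrow>
     (\<forall>\<epsilon>>0. \<exists>\<delta>>0. \<forall>b\<in>S. ell2_mod_dist lam a b < \<delta> \<longrightarrow> L2_norm (\<lambda>t. T a t - T b t) < \<epsilon>)"

end

theory Submission
  imports Defs "HOL-Probability.Characteristic_Functions" "HOL-Probability.Sinc_Integral"
begin

text \<open>
  If \<open>g = f + h\<close>, then the folded samples of \<open>f\<close> and \<open>g\<close> at \<open>\<alpha> k\<close> are at toral distance at most
  \<open>\<bar>h (\<alpha> k) - 2 lam n\<bar>\<close>, whatever \<open>f\<close> is and for every integer \<open>n\<close>. Instability at \<open>f\<close> is therefore a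
  matter of \<open>h\<close> alone: what is wanted is a real \<open>h\<close> of bandwidth \<open>\<Omega>\<close> with \<open>\<bar>h\<bar> \<ge> 1\<close> somewhere, whose samples
  are as close in \<open>\<ell>\<^sup>2\<close> to a sequence in \<open>2 lam \<int>\<close> as one likes. Since point evaluation is bounded by
  \<open>sqrt \<Omega>\<close> times the \<open>L\<^sup>2\<close>-norm on functions of bandwidth \<open>\<Omega>\<close>, such an \<open>h\<close> has norm at least \<open>1 / sqrt \<Omega>\<close>.

  Such \<open>h\<close> come from the pigeonhole principle (\<open>nearly_lattice_valued_function\<close>). Let \<open>\<beta> = 2 / \<Omega>\<close>, and let
  \<open>\<phi>\<close> be a product of a sinc of bandwidth \<open>\<Omega>/2\<close> and the \<open>p\<close>-th power of a sinc of bandwidth \<open>\<Omega>/(2 p)\<close>. Then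
  \<open>\<phi>\<close> has bandwidth \<open>\<Omega>\<close>, it decays at least like \<open>\<bar>t\<bar>\<^sup>-\<^sup>p\<close>, and \<open>\<phi> (\<beta> j)\<close> is \<open>1\<close> for \<open>j = 0\<close> and \<open>0\<close> for all other
  integers \<open>j\<close>. Put \<open>h t = (\<Sum>j=1..N. d j * \<phi> (t - \<beta> j))\<close> with integers \<open>d j\<close>, not all zero. By interpolation
  \<open>h (\<beta> j) = d j\<close>, so that \<open>\<bar>h\<bar> \<ge> 1\<close> somewhere. Choose a constant \<open>C\<close> with \<open>C \<alpha> \<ge> 2 \<beta>\<close>. The window \<open>\<bar>k\<bar> \<le> C N\<close>
  contains \<open>2 C N + 1\<close> sample points. Dirichlet's argument makes the samples there lie within \<open>2 lam / N\<close> of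
  \<open>2 lam \<int>\<close> as soon as the number \<open>M ^ N\<close> of coefficient vectors exceeds the number \<open>N ^ (2 C N + 1)\<close> of
  cells, and \<open>M = N ^ (2 C + 2)\<close> suffices. The decisive point is that this bound on the coefficients is
  polynomial in \<open>N\<close> with an exponent that depends on \<open>\<alpha>\<close> and \<open>\<Omega>\<close> only: taking \<open>p\<close> larger than this exponent
  makes the samples outside the window negligible. The total squared error is then \<open>O (1 / N)\<close>.

  The Fourier analysis behind this rests on one tool, Gaussian summation: inserting the factor
  \<open>exp (- (\<epsilon> \<xi>)\<^sup>2 / 2)\<close> into the inversion integral of \<open>u\<close> replaces \<open>u\<close> by an average of its translates, which
  tends to \<open>u\<close> at points of continuity. It yields Parseval's identity for bounded integrable functions
  that are continuous almost everywhere. This class contains every truncation of a continuous function,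
  which is what the mean-square definition of the transform involves. Parseval's identity gives the inversion
  formula on the Paley--Wiener space (\<open>PW_inversion\<close>) and, with another use of Gaussian summation, the bound on
  point evaluation. The inversion formula and a Bessel inequality show that the samples of a Paley--Wiener function are square-summable,
  and folding does not increase the modulus, so the folded samples lie in \<open>\<ell>\<^sup>2\<close>.
\<close>

section \<open>Square-integrable functions\<close>

lemma borel_measurable_cis [measurable]: "cis \<in> borel_measurable borel"
  by (intro borel_measurable_continuous_onI continuous_intros)

lemma borel_measurable_cnj [measurable]: "cnj \<in> borel_measurable borel"
  by (intro borel_measurable_continuous_onI continuous_intros)

lemma square_integrableD:
  assumes "square_integrable f"
  shows "f \<in> borel_measurable borel" and "integrable lborel (\<lambda>t. (cmod (f t))\<^sup>2)"
  using assms by (simp_all add: square_integrable_def)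

lemma integral_Cauchy_Schwarz:
  fixes u v :: "real \<Rightarrow> complex"
  assumes u: "square_integrable u" and v: "square_integrable v"
  shows "integrable lborel (\<lambda>t. u t * v t)"
    and "(LINT t|lborel. cmod (u t * v t))\<^sup>2 \<le> (LINT t|lborel. (cmod (u t))\<^sup>2) * (LINT t|lborel. (cmod (v t))\<^sup>2)"
proof -
  have [measurable]: "u \<in> borel_measurable borel" "v \<in> borel_measurable borel"
    using u v by (auto simp: square_integrable_def)
  have iu: "integrable lborel (\<lambda>t. (cmod (u t))\<^sup>2)" and iv: "integrable lborel (\<lambda>t. (cmod (v t))\<^sup>2)"
    using u v by (auto simp: square_integrable_def)
  show i: "integrable lborel (\<lambda>t. u t * v t)"
  proof (rule Bochner_Integration.integrable_bound)
    show "integrable lborel (\<lambda>t. (cmod (u t))\<^sup>2 + (cmod (v t))\<^sup>2)" using iu iv by simp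
    show "AE t in lborel. cmod (u t * v t) \<le> norm ((cmod (u t))\<^sup>2 + (cmod (v t))\<^sup>2)"
    proof (rule AE_I2)
      fix t
      have "2 * (cmod (u t) * cmod (v t)) \<le> (cmod (u t))\<^sup>2 + (cmod (v t))\<^sup>2"
        using sum_squares_bound[of "cmod (u t)" "cmod (v t)"] by (simp only: mult.assoc)
      moreover have "0 \<le> cmod (u t) * cmod (v t)" by simp
      ultimately have "cmod (u t) * cmod (v t) \<le> (cmod (u t))\<^sup>2 + (cmod (v t))\<^sup>2" by linarith
      then show "cmod (u t * v t) \<le> norm ((cmod (u t))\<^sup>2 + (cmod (v t))\<^sup>2)"
        by (simp add: norm_mult)
    qed
  qed measurable
  have "ennreal ((LINT t|lborel. cmod (u t * v t))\<^sup>2) = (\<integral>\<^sup>+t. ennreal (cmod (u t)) * ennreal (cmod (v t)) \<partial>lborel)\<^sup>2"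
  proof -
    have "ennreal (LINT t|lborel. cmod (u t * v t)) = (\<integral>\<^sup>+t. ennreal (cmod (u t * v t)) \<partial>lborel)"
      by (rule nn_integral_eq_integral[symmetric]) (use integrable_norm[OF i] in auto)
    also have "\<dots> = (\<integral>\<^sup>+t. ennreal (cmod (u t)) * ennreal (cmod (v t)) \<partial>lborel)"
      by (simp add: norm_mult ennreal_mult)
    finally show ?thesis
      by (simp only: ennreal_power[symmetric] integral_nonneg_AE AE_I2 norm_ge_zero)
  qed
  also have "\<dots> \<le> (\<integral>\<^sup>+t. (ennreal (cmod (u t)))\<^sup>2 \<partial>lborel) * (\<integral>\<^sup>+t. (ennreal (cmod (v t)))\<^sup>2 \<partial>lborel)"
    by (rule Cauchy_Schwarz_nn_integral) auto
  also have "\<dots> = ennreal ((LINT t|lborel. (cmod (u t))\<^sup>2) * (LINT t|lborel. (cmod (v t))\<^sup>2))"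
    by (simp only: ennreal_power norm_ge_zero nn_integral_eq_integral[OF iu] nn_integral_eq_integral[OF iv]
          zero_le_power2 AE_I2 ennreal_mult Bochner_Integration.integral_nonneg)
  finally show "(LINT t|lborel. cmod (u t * v t))\<^sup>2 \<le> (LINT t|lborel. (cmod (u t))\<^sup>2) * (LINT t|lborel. (cmod (v t))\<^sup>2)"
    by (rule ennreal_le_iff[THEN iffD1, rotated]) (intro mult_nonneg_nonneg Bochner_Integration.integral_nonneg zero_le_power2)
qed

lemma norm_add_square_le: "(cmod (a + b))\<^sup>2 \<le> 2 * (cmod a)\<^sup>2 + 2 * (cmod b)\<^sup>2"
proof -
  have "(cmod (a + b))\<^sup>2 \<le> (cmod a + cmod b)\<^sup>2" by (intro power_mono norm_triangle_ineq) simp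
  also have "\<dots> \<le> 2 * (cmod a)\<^sup>2 + 2 * (cmod b)\<^sup>2"
    using sum_squares_bound[of "cmod a" "cmod b"] by (simp add: power2_sum)
  finally show ?thesis .
qed

lemma square_integrable_add:
  assumes "square_integrable u" and "square_integrable v"
  shows "square_integrable (\<lambda>t. u t + v t)"
proof -
  have [measurable]: "u \<in> borel_measurable borel" "v \<in> borel_measurable borel"
    using assms by (auto simp: square_integrable_def)
  have "integrable lborel (\<lambda>t. (cmod (u t + v t))\<^sup>2)"
  proof (rule Bochner_Integration.integrable_bound)
    show "integrable lborel (\<lambda>t. 2 * (cmod (u t))\<^sup>2 + 2 * (cmod (v t))\<^sup>2)"
      using assms by (simp add: square_integrable_def)
    show "AE t in lborel. norm ((cmod (u t + v t))\<^sup>2) \<le> norm (2 * (cmod (u t))\<^sup>2 + 2 * (cmod (v t))\<^sup>2)"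
      by (intro AE_I2) (simp add: norm_add_square_le)
  qed measurable
  then show ?thesis by (simp add: square_integrable_def)
qed

lemma square_integrable_uminus: "square_integrable u \<Longrightarrow> square_integrable (\<lambda>t. - u t)"
  by (simp add: square_integrable_def)

lemma square_integrable_diff:
  assumes "square_integrable u" and "square_integrable v"
  shows "square_integrable (\<lambda>t. u t - v t)"
  using square_integrable_add[OF assms(1) square_integrable_uminus[OF assms(2)]] by simp

lemma square_integrable_cnj: "square_integrable u \<Longrightarrow> square_integrable (\<lambda>t. cnj (u t))"
  by (auto simp: square_integrable_def intro: measurable_compose[OF _ borel_measurable_cnj])

lemma square_integrable_mult_cis:
  assumes "square_integrable F" and [measurable]: "g \<in> borel_measurable borel"
  shows "square_integrable (\<lambda>\<xi>. F \<xi> * cis (g \<xi>))"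
proof -
  have [measurable]: "F \<in> borel_measurable borel" using assms(1) by (simp add: square_integrable_def)
  then show ?thesis using assms(1) by (simp add: square_integrable_def norm_mult)
qed

lemma square_integrable_indicator_mult:
  assumes f: "square_integrable f"
  shows "square_integrable (\<lambda>t. indicator {a..b::real} t * f t)"
proof -
  note [measurable] = square_integrableD(1)[OF f]
  have "integrable lborel (\<lambda>t. (cmod (indicator {a..b::real} t * f t))\<^sup>2)"
  proof (rule Bochner_Integration.integrable_bound[OF square_integrableD(2)[OF f]])
    show "AE t in lborel. norm ((cmod (indicator {a..b::real} t * f t))\<^sup>2) \<le> norm ((cmod (f t))\<^sup>2)"
      by (rule AE_I2) (simp add: indicator_def)
  qed measurable
  then show ?thesis by (simp add: square_integrable_def)
qed

lemma square_integrable_indicator: "square_integrable (indicator {a..b})"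
proof -
  have "integrable lborel (\<lambda>t. indicator {a..b} t :: real)"
    by (intro integrable_real_indicator) (simp_all add: emeasure_lborel_Icc_eq)
  moreover have "(cmod (indicator {a..b} t))\<^sup>2 = indicator {a..b} t" for t :: real
    by (simp add: indicator_def)
  ultimately show ?thesis by (simp add: square_integrable_def)
qed

lemma integrable_indicator_mult:
  assumes "square_integrable f"
  shows "integrable lborel (\<lambda>t. indicator {a..b} t * f t)"
  by (rule integral_Cauchy_Schwarz(1)[OF square_integrable_indicator assms])

section \<open>Fourier integrals of integrable functions\<close>

lemma fourier_integral_cis: "fourier_integral f \<xi> = (LINT t|lborel. f t * cis (- (2 * pi * t * \<xi>)))"
  unfolding fourier_integral_def
  by (intro Bochner_Integration.integral_cong refl) (simp add: cis_conv_exp mult_ac)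

lemma integrable_mult_cis:
  assumes "integrable lborel f" and "g \<in> borel_measurable borel"
  shows "integrable lborel (\<lambda>t. f t * cis (g t))"
  using assms by (intro Bochner_Integration.integrable_bound[OF assms(1)]) (auto simp: norm_mult)

lemma borel_measurable_fourier_integral:
  assumes [measurable]: "f \<in> borel_measurable borel"
  shows "fourier_integral f \<in> borel_measurable borel"
  unfolding fourier_integral_cis[abs_def] by measurable

lemma norm_fourier_integral_le: "cmod (fourier_integral f \<xi>) \<le> (LINT t|lborel. cmod (f t))"
  unfolding fourier_integral_cis
  by (rule order_trans[OF integral_norm_bound]) (simp add: norm_mult)

lemma continuous_fourier_integral:
  assumes "integrable lborel f"
  shows "continuous_on UNIV (fourier_integral f)"
proof -
  have [measurable]: "f \<in> borel_measurable borel" using assms by auto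
  have "(\<lambda>n. fourier_integral f (X n)) \<longlonglongrightarrow> fourier_integral f x" if "X \<longlonglongrightarrow> x" for X x
    unfolding fourier_integral_cis
  proof (rule integral_dominated_convergence[where w="\<lambda>t. cmod (f t)"])
    show "AE t in lborel. (\<lambda>n. f t * cis (- (2 * pi * t * X n))) \<longlonglongrightarrow> f t * cis (- (2 * pi * t * x))"
      using that by (intro AE_I2 tendsto_intros)
  qed (use assms in \<open>auto simp: norm_mult\<close>)
  then show ?thesis
    by (auto simp: continuous_on_eq_continuous_at continuous_at_sequentially o_def)
qed

lemma fourier_integral_add:
  assumes "integrable lborel u" and "integrable lborel v"
  shows "fourier_integral (\<lambda>t. u t + v t) \<xi> = fourier_integral u \<xi> + fourier_integral v \<xi>"
  unfolding fourier_integral_cis distrib_right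
  by (intro Bochner_Integration.integral_add integrable_mult_cis assms) auto

lemma fourier_integral_diff:
  assumes "integrable lborel u" and "integrable lborel v"
  shows "fourier_integral (\<lambda>t. u t - v t) \<xi> = fourier_integral u \<xi> - fourier_integral v \<xi>"
  unfolding fourier_integral_cis left_diff_distrib
  by (intro Bochner_Integration.integral_diff integrable_mult_cis assms) auto

lemma integrable_product_kernel:
  fixes u w :: "real \<Rightarrow> complex" and k :: "real \<Rightarrow> real \<Rightarrow> complex"
  assumes u: "integrable lborel u" and w: "integrable lborel w"
    and k [measurable]: "case_prod k \<in> borel_measurable (lborel \<Otimes>\<^sub>M lborel)"
    and k1: "\<And>x y. cmod (k x y) \<le> 1"
  shows "integrable (lborel \<Otimes>\<^sub>M lborel) (\<lambda>(x, y). u x * w y * k x y)"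
proof -
  have [measurable]: "u \<in> borel_measurable borel" "w \<in> borel_measurable borel"
    using u w by auto
  have "integrable (lborel \<Otimes>\<^sub>M lborel) (\<lambda>(x, y). u x * w y)"
  proof (rule lborel_pair.Fubini_integrable)
    show "integrable lborel (\<lambda>x. LINT y|lborel. cmod (case (x, y) of (x, y) \<Rightarrow> u x * w y))"
      using u by (simp add: norm_mult)
    show "AE x in lborel. integrable lborel (\<lambda>y. case (x, y) of (x, y) \<Rightarrow> u x * w y)"
      using w by simp
  qed measurable
  then show ?thesis
    by (rule Bochner_Integration.integrable_bound)
       (auto simp: norm_mult intro!: AE_I2 mult_left_le k1 mult_nonneg_nonneg split: prod.split)
qed

text \<open>
  Fubini's theorem in the one form used below: the kernel is bounded and both factors are integrable.
\<close>

lemma integral_swap_kernel: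
  fixes u w :: "real \<Rightarrow> complex" and k :: "real \<Rightarrow> real \<Rightarrow> complex"
  assumes u: "integrable lborel u" and w: "integrable lborel w"
    and k: "case_prod k \<in> borel_measurable (lborel \<Otimes>\<^sub>M lborel)"
    and k1: "\<And>x y. cmod (k x y) \<le> 1"
  shows "(LINT y|lborel. w y * (LINT x|lborel. u x * k x y))
       = (LINT x|lborel. u x * (LINT y|lborel. w y * k x y))"
proof -
  have "(LINT y|lborel. LINT x|lborel. u x * w y * k x y) = (LINT x|lborel. LINT y|lborel. u x * w y * k x y)"
    by (rule lborel_pair.Fubini_integral) (rule integrable_product_kernel[OF assms])
  moreover have "(LINT x|lborel. u x * w y * k x y) = w y * (LINT x|lborel. u x * k x y)" for y
    by (subst integral_mult_right_zero[symmetric]) (simp add: mult_ac)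
  moreover have "(LINT y|lborel. u x * w y * k x y) = u x * (LINT y|lborel. w y * k x y)" for x
    by (subst integral_mult_right_zero[symmetric]) (simp add: mult_ac)
  ultimately show ?thesis by simp
qed

text \<open>
  This moves the transform from one factor to the other. Gaussian summation and Parseval's identity both
  come from it.
\<close>

lemma fourier_multiplication_formula:
  assumes "integrable lborel u" and "integrable lborel w"
  shows "(LINT \<xi>|lborel. fourier_integral u \<xi> * w \<xi>) = (LINT t|lborel. u t * fourier_integral w t)"
proof -
  have "(LINT y|lborel. w y * (LINT x|lborel. u x * cis (- (2 * pi * x * y))))
       = (LINT x|lborel. u x * (LINT y|lborel. w y * cis (- (2 * pi * x * y))))"
    by (rule integral_swap_kernel[OF assms]) auto
  then show ?thesis
    by (simp add: fourier_integral_cis mult_ac)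
qed

text \<open>
  The characteristic function of the standard normal distribution, rescaled so that the weight is
  \<open>1\<close> in the limit \<open>\<epsilon> \<rightarrow> 0\<close>.
\<close>

lemma fourier_gaussian:
  assumes "\<epsilon> > 0"
  shows "has_bochner_integral lborel (\<lambda>x. complex_of_real (exp (- (\<epsilon> * x)\<^sup>2 / 2)) * cis (2 * pi * y * x))
           (complex_of_real (2 * pi / \<epsilon> * std_normal_density (2 * pi * y / \<epsilon>)))"
proof -
  let ?n = std_normal_density
  have int: "integrable lborel (\<lambda>x. ?n x *\<^sub>R cis (s * x))" for s
    by (rule Bochner_Integration.integrable_bound[OF integrable_normal_density[of 1 0]]) auto
  have "(LINT x|lborel. ?n x *\<^sub>R cis (s * x)) = complex_of_real (exp (- s\<^sup>2 / 2))" for s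
  proof -
    have "char std_normal_distribution s = (LINT x|std_normal_distribution. cis (s * x))"
      by (simp add: char_def cis_conv_exp)
    also have "\<dots> = (LINT x|lborel. ?n x *\<^sub>R cis (s * x))"
      by (rule integral_density) simp_all
    finally have "char std_normal_distribution s = (LINT x|lborel. ?n x *\<^sub>R cis (s * x))" .
    then show ?thesis by (simp add: char_std_normal_distribution)
  qed
  with int have "has_bochner_integral lborel (\<lambda>x. ?n x *\<^sub>R cis (s * x)) (complex_of_real (exp (- s\<^sup>2 / 2)))" for s
    by (simp add: has_bochner_integral_iff)
  from has_bochner_integral_mult_right[OF this[of "2 * pi * y / \<epsilon>"], of "complex_of_real (sqrt (2 * pi))"]
  have "has_bochner_integral lborel (\<lambda>x. complex_of_real (sqrt (2 * pi)) * (?n x *\<^sub>R cis (2 * pi * y / \<epsilon> * x)))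
     (complex_of_real (sqrt (2 * pi)) * complex_of_real (exp (- (2 * pi * y / \<epsilon>)\<^sup>2 / 2)))" by auto
  then have "has_bochner_integral lborel (\<lambda>x. complex_of_real (sqrt (2 * pi)) * (?n (0 + \<epsilon> * x) *\<^sub>R cis (2 * pi * y / \<epsilon> * (0 + \<epsilon> * x))))
     ((complex_of_real (sqrt (2 * pi)) * complex_of_real (exp (- (2 * pi * y / \<epsilon>)\<^sup>2 / 2))) /\<^sub>R \<bar>\<epsilon>\<bar>)"
    using assms by (subst (asm) lborel_has_bochner_integral_real_affine_iff[where c=\<epsilon> and t=0]) auto
  moreover have "complex_of_real (sqrt (2 * pi)) * (?n (0 + \<epsilon> * x) *\<^sub>R cis (2 * pi * y / \<epsilon> * (0 + \<epsilon> * x)))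
     = complex_of_real (exp (- (\<epsilon> * x)\<^sup>2 / 2)) * cis (2 * pi * y * x)" for x
    using assms by (simp add: std_normal_density_def scaleR_conv_of_real mult.assoc)
  moreover have "(complex_of_real (sqrt (2 * pi)) * complex_of_real (exp (- (2 * pi * y / \<epsilon>)\<^sup>2 / 2))) /\<^sub>R \<bar>\<epsilon>\<bar>
     = complex_of_real (2 * pi / \<epsilon> * ?n (2 * pi * y / \<epsilon>))"
  proof -
    have *: "s * E / \<epsilon> = 2 * pi / \<epsilon> * (1 / s * E)" if "s * s = 2 * pi" "s > 0" for s E :: real
      using that by (simp add: that(1)[symmetric])
    have "sqrt (2 * pi) * exp (- (2 * pi * y / \<epsilon>)\<^sup>2 / 2) / \<epsilon> = 2 * pi / \<epsilon> * ?n (2 * pi * y / \<epsilon>)"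
      unfolding std_normal_density_def by (rule *) auto
    from arg_cong[OF this, of complex_of_real] show ?thesis using assms
      by (simp only: scaleR_conv_of_real of_real_mult[symmetric] abs_of_pos divide_inverse mult_ac)
  qed
  ultimately show ?thesis by simp
qed

section \<open>Gaussian summation and Plancherel's theorem\<close>

text \<open>
  The convolution of \<open>u\<close> with a centred normal density of standard deviation \<open>\<epsilon> / (2 pi)\<close>, written as an
  expectation so that bounds and limits can be read off under the integral sign.
\<close>

definition gaussian_mean :: "real \<Rightarrow> (real \<Rightarrow> complex) \<Rightarrow> real \<Rightarrow> complex" where
  "gaussian_mean \<epsilon> u s = (LINT v|lborel. std_normal_density v *\<^sub>R u (s + \<epsilon> / (2 * pi) * v))"

text \<open>
  The multiplication formula applied to the weight \<open>exp (- (\<epsilon> \<xi>)\<^sup>2 / 2) cis (2 pi s \<xi>)\<close>, whose transform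
  is the normal density centred at \<open>s\<close>.
\<close>

lemma gaussian_summation:
  assumes u: "integrable lborel u" and "\<epsilon> > 0"
  shows "(LINT \<xi>|lborel. fourier_integral u \<xi> * (complex_of_real (exp (- (\<epsilon> * \<xi>)\<^sup>2 / 2)) * cis (2 * pi * s * \<xi>)))
       = gaussian_mean \<epsilon> u s"
proof -
  let ?n = std_normal_density
  define w where "w = (\<lambda>\<xi>. complex_of_real (exp (- (\<epsilon> * \<xi>)\<^sup>2 / 2)) * cis (2 * pi * s * \<xi>))"
  have w: "integrable lborel w"
    using fourier_gaussian[OF \<open>\<epsilon> > 0\<close>, of s] unfolding w_def has_bochner_integral_iff by blast
  have "fourier_integral w t = complex_of_real (2 * pi / \<epsilon> * ?n (2 * pi * (s - t) / \<epsilon>))" for t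
  proof -
    have "w \<xi> * cis (- (2 * pi * \<xi> * t)) = complex_of_real (exp (- (\<epsilon> * \<xi>)\<^sup>2 / 2)) * cis (2 * pi * (s - t) * \<xi>)" for \<xi>
      unfolding w_def by (simp add: mult.assoc cis_mult algebra_simps)
    then show ?thesis
      using fourier_gaussian[OF \<open>\<epsilon> > 0\<close>, of "s - t"]
      unfolding fourier_integral_cis has_bochner_integral_iff by simp
  qed
  then have "(LINT \<xi>|lborel. fourier_integral u \<xi> * w \<xi>)
      = (LINT t|lborel. u t * complex_of_real (2 * pi / \<epsilon> * ?n (2 * pi * (s - t) / \<epsilon>)))"
    using fourier_multiplication_formula[OF u w] by simp
  also have "\<dots> = \<bar>\<epsilon> / (2 * pi)\<bar> *\<^sub>R (LINT v|lborel. u (s + \<epsilon> / (2 * pi) * v)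
                  * complex_of_real (2 * pi / \<epsilon> * ?n (2 * pi * (s - (s + \<epsilon> / (2 * pi) * v)) / \<epsilon>)))"
    by (rule lborel_integral_real_affine) (use assms in simp)
  also have "\<dots> = (LINT v|lborel. (\<epsilon> / (2 * pi)) *\<^sub>R (u (s + \<epsilon> / (2 * pi) * v)
                  * complex_of_real (2 * pi / \<epsilon> * ?n (2 * pi * (s - (s + \<epsilon> / (2 * pi) * v)) / \<epsilon>))))"
    using assms by simp
  also have "\<dots> = gaussian_mean \<epsilon> u s"
    unfolding gaussian_mean_def
  proof (intro Bochner_Integration.integral_cong refl)
    fix v :: real
    have "2 * pi * (s - (s + \<epsilon> / (2 * pi) * v)) / \<epsilon> = - v" using assms by (simp add: field_simps)
    moreover have "?n (- v) = ?n v" by (simp add: std_normal_density_def)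
    ultimately show "(\<epsilon> / (2 * pi)) *\<^sub>R (u (s + \<epsilon> / (2 * pi) * v) * complex_of_real (2 * pi / \<epsilon> * ?n (2 * pi * (s - (s + \<epsilon> / (2 * pi) * v)) / \<epsilon>)))
        = ?n v *\<^sub>R u (s + \<epsilon> / (2 * pi) * v)"
      using assms by (simp add: scaleR_conv_of_real)
  qed
  finally show ?thesis by (simp add: w_def)
qed

lemma integral_std_normal_density: "(LINT v|lborel. std_normal_density v) = 1"
  by (rule integral_normal_density) simp

lemma norm_gaussian_mean_le:
  assumes "\<And>t. cmod (u t) \<le> B" and [measurable]: "u \<in> borel_measurable borel"
  shows "cmod (gaussian_mean \<epsilon> u s) \<le> B"
proof -
  have i: "integrable lborel (\<lambda>v. std_normal_density v * B)" by simp
  have "cmod (gaussian_mean \<epsilon> u s) \<le> (LINT v|lborel. cmod (std_normal_density v *\<^sub>R u (s + \<epsilon> / (2 * pi) * v)))"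
    unfolding gaussian_mean_def by (rule integral_norm_bound)
  also have "\<dots> \<le> (LINT v|lborel. std_normal_density v * B)"
  proof (rule Bochner_Integration.integral_mono)
    show "integrable lborel (\<lambda>v. cmod (std_normal_density v *\<^sub>R u (s + \<epsilon> / (2 * pi) * v)))"
      by (rule Bochner_Integration.integrable_bound[OF i])
         (auto intro!: AE_I2 mult_left_mono order_trans[OF _ abs_ge_self] assms(1))
  qed (auto intro!: mult_left_mono assms(1))
  also have "\<dots> = B" by (simp add: integral_std_normal_density)
  finally show ?thesis .
qed

lemma borel_measurable_gaussian_mean [measurable]:
  assumes [measurable]: "u \<in> borel_measurable borel"
  shows "gaussian_mean \<epsilon> u \<in> borel_measurable borel"
  unfolding gaussian_mean_def[abs_def] by measurable

lemma tendsto_gaussian_mean: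
  assumes B: "\<And>t. cmod (u t) \<le> B" and [measurable]: "u \<in> borel_measurable borel"
    and "isCont u s" and "\<epsilon> \<longlonglongrightarrow> 0"
  shows "(\<lambda>i. gaussian_mean (\<epsilon> i) u s) \<longlonglongrightarrow> u s"
proof -
  have "(\<lambda>i. gaussian_mean (\<epsilon> i) u s) \<longlonglongrightarrow> (LINT v|lborel. std_normal_density v *\<^sub>R u s)"
    unfolding gaussian_mean_def
  proof (rule integral_dominated_convergence[where w="\<lambda>v. std_normal_density v * B"])
    show "AE v in lborel. (\<lambda>i. std_normal_density v *\<^sub>R u (s + \<epsilon> i / (2 * pi) * v)) \<longlonglongrightarrow> std_normal_density v *\<^sub>R u s"
    proof (intro AE_I2 tendsto_intros)
      fix v
      have "(\<lambda>i. s + \<epsilon> i / (2 * pi) * v) \<longlonglongrightarrow> s + 0 / (2 * pi) * v"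
        by (intro tendsto_intros assms) auto
      then show "(\<lambda>i. u (s + \<epsilon> i / (2 * pi) * v)) \<longlonglongrightarrow> u s"
        by (intro isCont_tendsto_compose[OF \<open>isCont u s\<close>]) simp
    qed
  qed (auto intro!: mult_left_mono B)
  then show ?thesis
    by (simp add: integral_std_normal_density)
qed

text \<open>
  A class on which Gaussian means converge almost everywhere and boundedly, so that Parseval's identity follows by
  dominated convergence. It contains the truncations of continuous functions to bounded intervals.
\<close>

definition tame :: "(real \<Rightarrow> complex) \<Rightarrow> bool" where
  "tame u \<longleftrightarrow> integrable lborel u \<and> (\<exists>B. \<forall>t. cmod (u t) \<le> B) \<and> (AE t in lborel. isCont u t)"

lemma tame_square_integrable:
  assumes "tame u" shows "square_integrable u"
proof -
  obtain B where B: "\<And>t. cmod (u t) \<le> B" and i: "integrable lborel u"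
    using assms by (auto simp: tame_def)
  have [measurable]: "u \<in> borel_measurable borel" using i by auto
  have "integrable lborel (\<lambda>t. (cmod (u t))\<^sup>2)"
  proof (rule Bochner_Integration.integrable_bound)
    show "integrable lborel (\<lambda>t. B * cmod (u t))" using i by simp
    have "0 \<le> B" using B[of 0] norm_ge_zero order_trans by blast
    then show "AE t in lborel. norm ((cmod (u t))\<^sup>2) \<le> norm (B * cmod (u t))"
      by (intro AE_I2) (simp add: power2_eq_square mult_right_mono B)
  qed measurable
  then show ?thesis by (simp add: square_integrable_def)
qed

text \<open>
  Two uses of the multiplication formula: the first moves the transform off \<open>u\<close>, the second (inside
  \<open>gaussian_summation\<close>) recognises the transform of the weighted \<open>cnj (fourier_integral v)\<close> as a Gaussian mean.
\<close>

lemma gaussian_parseval: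
  assumes u: "tame u" and v: "tame v" and "\<epsilon> > 0"
  shows "(LINT \<xi>|lborel. fourier_integral u \<xi> * (complex_of_real (exp (- (\<epsilon> * \<xi>)\<^sup>2 / 2)) * cnj (fourier_integral v \<xi>)))
       = (LINT t|lborel. u t * cnj (gaussian_mean \<epsilon> v t))"
proof -
  have iu: "integrable lborel u" and iv: "integrable lborel v" using u v by (auto simp: tame_def)
  have [measurable]: "v \<in> borel_measurable borel" "fourier_integral v \<in> borel_measurable borel"
    using iv by (auto intro: borel_measurable_fourier_integral)
  \<comment> \<open>The Gaussian factor makes \<open>w\<close> integrable, although the transform of \<open>v\<close> is only known to be bounded.\<close>
  define w where "w = (\<lambda>\<xi>. complex_of_real (exp (- (\<epsilon> * \<xi>)\<^sup>2 / 2)) * cnj (fourier_integral v \<xi>))"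
  define A where "A = (LINT t|lborel. cmod (v t))"
  have A: "cmod (fourier_integral v \<xi>) \<le> A" for \<xi> unfolding A_def by (rule norm_fourier_integral_le)
  have "0 \<le> A" unfolding A_def by simp
  have g: "integrable lborel (\<lambda>\<xi>. complex_of_real (exp (- (\<epsilon> * \<xi>)\<^sup>2 / 2)))"
    using fourier_gaussian[OF \<open>\<epsilon> > 0\<close>, of 0] by (auto simp: has_bochner_integral_iff)
  have "integrable lborel w"
  proof (rule Bochner_Integration.integrable_bound)
    show "integrable lborel (\<lambda>\<xi>. complex_of_real (exp (- (\<epsilon> * \<xi>)\<^sup>2 / 2)) * complex_of_real A)" using g by simp
    show "AE \<xi> in lborel. cmod (w \<xi>) \<le> cmod (complex_of_real (exp (- (\<epsilon> * \<xi>)\<^sup>2 / 2)) * complex_of_real A)"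
      unfolding w_def using \<open>0 \<le> A\<close> by (intro AE_I2) (simp add: norm_mult A)
    show "w \<in> borel_measurable lborel" unfolding w_def by measurable
  qed
  moreover have "fourier_integral w t = cnj (gaussian_mean \<epsilon> v t)" for t
  proof -
    have "fourier_integral w t = (LINT \<xi>|lborel. cnj (fourier_integral v \<xi> *
        (complex_of_real (exp (- (\<epsilon> * \<xi>)\<^sup>2 / 2)) * cis (2 * pi * t * \<xi>))))"
      unfolding fourier_integral_cis[of w]
      by (intro Bochner_Integration.integral_cong refl) (simp add: w_def cis_cnj mult_ac)
    also have "\<dots> = cnj (gaussian_mean \<epsilon> v t)"
      unfolding gaussian_summation[OF iv \<open>\<epsilon> > 0\<close>, symmetric] by (rule Bochner_Integration.integral_cnj)
    finally show ?thesis .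
  qed
  ultimately show ?thesis
    using fourier_multiplication_formula[OF iu, of w] by (simp add: w_def)
qed

lemma tendsto_gaussian_parseval:
  assumes u: "tame u" and v: "tame v" 
  shows "(\<lambda>i. LINT \<xi>|lborel. fourier_integral u \<xi> * (complex_of_real (exp (- (1 / real (Suc i) * \<xi>)\<^sup>2 / 2)) * cnj (fourier_integral v \<xi>)))
      \<longlonglongrightarrow> (LINT t|lborel. u t * cnj (v t))"
proof -
  have iu: "integrable lborel u" and iv: "integrable lborel v" using u v by (auto simp: tame_def)
  have [measurable]: "v \<in> borel_measurable borel" "u \<in> borel_measurable borel"
    using iu iv by auto
  obtain B where B: "\<And>t. cmod (v t) \<le> B" using v by (auto simp: tame_def)
  have "(\<lambda>i. LINT t|lborel. u t * cnj (gaussian_mean (1 / real (Suc i)) v t)) \<longlonglongrightarrow> (LINT t|lborel. u t * cnj (v t))"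
  proof (rule integral_dominated_convergence[where w="\<lambda>t. cmod (u t) * B"])
    have "AE t in lborel. isCont v t" using v by (simp add: tame_def)
    then show "AE t in lborel. (\<lambda>i. u t * cnj (gaussian_mean (1 / real (Suc i)) v t)) \<longlonglongrightarrow> u t * cnj (v t)"
      by eventually_elim (intro tendsto_intros tendsto_gaussian_mean[OF B] LIMSEQ_Suc lim_inverse_n', simp)
    show "AE t in lborel. cmod (u t * cnj (gaussian_mean (1 / real (Suc i)) v t)) \<le> cmod (u t) * B" for i
      by (intro AE_I2) (simp add: norm_mult mult_left_mono norm_gaussian_mean_le[OF B])
  qed (use iu in auto)
  then show ?thesis
    by (subst gaussian_parseval[OF assms]) simp
qed

text \<open>
  As \<open>\<epsilon>\<close> decreases to \<open>0\<close>, the weights in \<open>gaussian_parseval\<close> with \<open>v = u\<close> increase to \<open>1\<close>. Monotone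
  convergence then yields square-integrability of the transform and the value of its norm at once.
\<close>

theorem plancherel_tame:
  assumes u: "tame u"
  shows "square_integrable (fourier_integral u)"
    and "(LINT \<xi>|lborel. (cmod (fourier_integral u \<xi>))\<^sup>2) = (LINT t|lborel. (cmod (u t))\<^sup>2)"
proof -
  have iu: "integrable lborel u" using u by (auto simp: tame_def)
  have [measurable]: "u \<in> borel_measurable borel" "fourier_integral u \<in> borel_measurable borel"
    using iu by (auto intro: borel_measurable_fourier_integral)
  define J where "J = (\<lambda>i \<xi>. (cmod (fourier_integral u \<xi>))\<^sup>2 * exp (- (1 / real (Suc i) * \<xi>)\<^sup>2 / 2))"
  have cm: "z * cnj z = complex_of_real ((cmod z)\<^sup>2)" for z by (rule complex_norm_square[symmetric])
  have J: "fourier_integral u \<xi> * (complex_of_real (exp (- (1 / real (Suc i) * \<xi>)\<^sup>2 / 2)) * cnj (fourier_integral u \<xi>))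
      = complex_of_real (J i \<xi>)" for i \<xi>
    by (simp only: J_def of_real_mult cm[symmetric] mult_ac)
  have "(\<lambda>i. LINT \<xi>|lborel. complex_of_real (J i \<xi>)) \<longlonglongrightarrow> (LINT t|lborel. complex_of_real ((cmod (u t))\<^sup>2))"
    using tendsto_gaussian_parseval[OF u u] unfolding J cm .
  then have lim: "(\<lambda>i. LINT \<xi>|lborel. J i \<xi>) \<longlonglongrightarrow> (LINT t|lborel. (cmod (u t))\<^sup>2)"
    unfolding integral_complex_of_real tendsto_of_real_iff .
  have Ji: "integrable lborel (J i)" for i
  proof (rule Bochner_Integration.integrable_bound)
    let ?A = "LINT t|lborel. cmod (u t)"
    have "integrable lborel (\<lambda>\<xi>. complex_of_real (exp (- (1 / real (Suc i) * \<xi>)\<^sup>2 / 2)))"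
      using fourier_gaussian[of "1 / real (Suc i)" 0] by (auto simp: has_bochner_integral_iff)
    then have "integrable lborel (\<lambda>\<xi>. exp (- (1 / real (Suc i) * \<xi>)\<^sup>2 / 2))"
      unfolding complex_of_real_integrable_eq .
    then show "integrable lborel (\<lambda>\<xi>. ?A\<^sup>2 * exp (- (1 / real (Suc i) * \<xi>)\<^sup>2 / 2))"
      by (rule integrable_mult_right)
    show "AE \<xi> in lborel. norm (J i \<xi>) \<le> norm (?A\<^sup>2 * exp (- (1 / real (Suc i) * \<xi>)\<^sup>2 / 2))"
      by (intro AE_I2) (simp add: J_def power_mono norm_fourier_integral_le)
    show "J i \<in> borel_measurable lborel" unfolding J_def by measurable
  qed
  have mono: "AE \<xi> in lborel. mono (\<lambda>i. J i \<xi>)"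
    unfolding J_def
    by (intro AE_I2 monoI mult_left_mono) (auto intro!: divide_left_mono mult_mono simp: power_divide divide_simps)
  have pw: "AE \<xi> in lborel. (\<lambda>i. J i \<xi>) \<longlonglongrightarrow> (cmod (fourier_integral u \<xi>))\<^sup>2"
  proof (rule AE_I2)
    fix \<xi>
    have "(\<lambda>i. 1 / real (Suc i)) \<longlonglongrightarrow> 0" by (intro LIMSEQ_Suc lim_inverse_n')
    then have "(\<lambda>i. J i \<xi>) \<longlonglongrightarrow> (cmod (fourier_integral u \<xi>))\<^sup>2 * exp (- (0 * \<xi>)\<^sup>2 / 2)"
      unfolding J_def by (intro tendsto_intros) auto
    then show "(\<lambda>i. J i \<xi>) \<longlonglongrightarrow> (cmod (fourier_integral u \<xi>))\<^sup>2" by simp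
  qed
  show "(LINT \<xi>|lborel. (cmod (fourier_integral u \<xi>))\<^sup>2) = (LINT t|lborel. (cmod (u t))\<^sup>2)"
    by (rule integral_monotone_convergence[OF Ji mono pw lim]) auto
  have "integrable lborel (\<lambda>\<xi>. (cmod (fourier_integral u \<xi>))\<^sup>2)"
    by (rule integrable_monotone_convergence[OF Ji mono pw lim]) auto
  then show "square_integrable (fourier_integral u)" by (simp add: square_integrable_def)
qed

text \<open>
  The limit of \<open>gaussian_parseval\<close>. Plancherel's theorem supplies the integrable majorant.
\<close>

lemma parseval_tame:
  assumes u: "tame u" and v: "tame v"
  shows "(LINT \<xi>|lborel. fourier_integral u \<xi> * cnj (fourier_integral v \<xi>)) = (LINT t|lborel. u t * cnj (v t))"
proof (rule LIMSEQ_unique)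
  have su: "square_integrable (fourier_integral u)" and sv: "square_integrable (fourier_integral v)"
    using plancherel_tame(1) u v by auto
  then have [measurable]: "fourier_integral u \<in> borel_measurable borel" "fourier_integral v \<in> borel_measurable borel"
    by (auto simp: square_integrable_def)
  show "(\<lambda>i. LINT \<xi>|lborel. fourier_integral u \<xi> * (complex_of_real (exp (- (1 / real (Suc i) * \<xi>)\<^sup>2 / 2)) * cnj (fourier_integral v \<xi>)))
      \<longlonglongrightarrow> (LINT \<xi>|lborel. fourier_integral u \<xi> * cnj (fourier_integral v \<xi>))"
  proof (rule integral_dominated_convergence[where w="\<lambda>\<xi>. cmod (fourier_integral u \<xi> * cnj (fourier_integral v \<xi>))"])
    show "integrable lborel (\<lambda>\<xi>. cmod (fourier_integral u \<xi> * cnj (fourier_integral v \<xi>)))"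
      by (intro integrable_norm integral_Cauchy_Schwarz su square_integrable_cnj sv)
    show "AE \<xi> in lborel. (\<lambda>i. fourier_integral u \<xi> * (complex_of_real (exp (- (1 / real (Suc i) * \<xi>)\<^sup>2 / 2)) * cnj (fourier_integral v \<xi>)))
        \<longlonglongrightarrow> fourier_integral u \<xi> * cnj (fourier_integral v \<xi>)"
    proof (rule AE_I2)
      fix \<xi>
      have "(\<lambda>i. 1 / real (Suc i)) \<longlonglongrightarrow> 0" by (intro LIMSEQ_Suc lim_inverse_n')
      then have "(\<lambda>i. fourier_integral u \<xi> * (complex_of_real (exp (- (1 / real (Suc i) * \<xi>)\<^sup>2 / 2)) * cnj (fourier_integral v \<xi>)))
         \<longlonglongrightarrow> fourier_integral u \<xi> * (complex_of_real (exp (- (0 * \<xi>)\<^sup>2 / 2)) * cnj (fourier_integral v \<xi>))"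
        by (intro tendsto_intros) auto
      then show "(\<lambda>i. fourier_integral u \<xi> * (complex_of_real (exp (- (1 / real (Suc i) * \<xi>)\<^sup>2 / 2)) * cnj (fourier_integral v \<xi>)))
        \<longlonglongrightarrow> fourier_integral u \<xi> * cnj (fourier_integral v \<xi>)" by simp
    qed
    show "AE \<xi> in lborel. cmod (fourier_integral u \<xi> * (complex_of_real (exp (- (1 / real (Suc i) * \<xi>)\<^sup>2 / 2)) * cnj (fourier_integral v \<xi>)))
        \<le> cmod (fourier_integral u \<xi> * cnj (fourier_integral v \<xi>))" for i
      by (intro AE_I2) (simp add: norm_mult mult_left_mono mult_left_le_one_le)
  qed measurable
qed (rule tendsto_gaussian_parseval[OF assms])

section \<open>Paley--Wiener functions\<close>

lemma ennreal_tendsto_0_of_le_add: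
  fixes a b c :: "'a \<Rightarrow> ennreal"
  assumes le: "\<And>x. a x \<le> 2 * b x + 2 * c x" and "(b \<longlongrightarrow> 0) F" and "(c \<longlongrightarrow> 0) F"
  shows "(a \<longlongrightarrow> 0) F"
proof (rule tendsto_sandwich[OF _ _ tendsto_const])
  have "((\<lambda>x. 2 * b x + 2 * c x) \<longlongrightarrow> 2 * 0 + 2 * 0) F"
    by (intro tendsto_add ennreal_tendsto_cmult assms) simp_all
  then show "((\<lambda>x. 2 * b x + 2 * c x) \<longlongrightarrow> 0) F" by simp
qed (simp_all add: le)

lemma has_fourier_transform_add:
  assumes f: "has_fourier_transform f F" and g: "has_fourier_transform g G"
  shows "has_fourier_transform (\<lambda>t. f t + g t) (\<lambda>\<xi>. F \<xi> + G \<xi>)"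
proof -
  have sq: "square_integrable f" "square_integrable F" "square_integrable g" "square_integrable G"
    using f g by (auto simp: has_fourier_transform_def)
  have [measurable]: "f \<in> borel_measurable borel" "g \<in> borel_measurable borel"
    "F \<in> borel_measurable borel" "G \<in> borel_measurable borel"
    using sq by (auto simp: square_integrable_def)
  let ?A = "\<lambda>f R \<xi>. fourier_integral (\<lambda>t. indicator {-R..R} t * f t) \<xi>"
  let ?E = "\<lambda>f F R. \<integral>\<^sup>+ \<xi>. ennreal ((cmod (?A f R \<xi> - F \<xi>))\<^sup>2) \<partial>lborel"
  have meas: "?A h R \<in> borel_measurable borel" if [measurable]: "h \<in> borel_measurable borel" for h R
    by (rule borel_measurable_fourier_integral) measurable
  have [measurable]: "?A f R \<in> borel_measurable borel" "?A g R \<in> borel_measurable borel" for R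
    by (rule meas; measurable)+
  have "?E (\<lambda>t. f t + g t) (\<lambda>\<xi>. F \<xi> + G \<xi>) R \<le> 2 * ?E f F R + 2 * ?E g G R" for R
  proof -
    have "?E (\<lambda>t. f t + g t) (\<lambda>\<xi>. F \<xi> + G \<xi>) R
        \<le> (\<integral>\<^sup>+ \<xi>. 2 * ennreal ((cmod (?A f R \<xi> - F \<xi>))\<^sup>2) + 2 * ennreal ((cmod (?A g R \<xi> - G \<xi>))\<^sup>2) \<partial>lborel)"
    proof (rule nn_integral_mono)
      fix \<xi>
      have "?A (\<lambda>t. f t + g t) R \<xi> = ?A f R \<xi> + ?A g R \<xi>"
        unfolding distrib_left by (intro fourier_integral_add integrable_indicator_mult sq)
      then have "?A (\<lambda>t. f t + g t) R \<xi> - (F \<xi> + G \<xi>) = (?A f R \<xi> - F \<xi>) + (?A g R \<xi> - G \<xi>)" by simp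
      then have "(cmod (?A (\<lambda>t. f t + g t) R \<xi> - (F \<xi> + G \<xi>)))\<^sup>2
          \<le> 2 * (cmod (?A f R \<xi> - F \<xi>))\<^sup>2 + 2 * (cmod (?A g R \<xi> - G \<xi>))\<^sup>2"
        by (simp only: norm_add_square_le)
      then have "ennreal ((cmod (?A (\<lambda>t. f t + g t) R \<xi> - (F \<xi> + G \<xi>)))\<^sup>2)
          \<le> ennreal (2 * (cmod (?A f R \<xi> - F \<xi>))\<^sup>2 + 2 * (cmod (?A g R \<xi> - G \<xi>))\<^sup>2)"
        by (rule ennreal_leI)
      then show "ennreal ((cmod (?A (\<lambda>t. f t + g t) R \<xi> - (F \<xi> + G \<xi>)))\<^sup>2)
          \<le> 2 * ennreal ((cmod (?A f R \<xi> - F \<xi>))\<^sup>2) + 2 * ennreal ((cmod (?A g R \<xi> - G \<xi>))\<^sup>2)"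
        by (simp add: ennreal_mult)
    qed
    also have "\<dots> = 2 * ?E f F R + 2 * ?E g G R"
      by (simp add: nn_integral_add nn_integral_cmult)
    finally show ?thesis .
  qed
  note le = this
  have lf: "(?E f F \<longlongrightarrow> 0) at_top" and lg: "(?E g G \<longlongrightarrow> 0) at_top"
    by (rule f[unfolded has_fourier_transform_def, THEN conjunct2, THEN conjunct2],
        rule g[unfolded has_fourier_transform_def, THEN conjunct2, THEN conjunct2])
  have "(?E (\<lambda>t. f t + g t) (\<lambda>\<xi>. F \<xi> + G \<xi>) \<longlongrightarrow> 0) at_top"
    by (rule ennreal_tendsto_0_of_le_add[OF le lf lg])
  with square_integrable_add[OF sq(1,3)] square_integrable_add[OF sq(2,4)] show ?thesis
    unfolding has_fourier_transform_def by (rule conjI[OF _ conjI])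
qed

lemma PW_obtain_transform:
  assumes "f \<in> PW \<Omega>"
  obtains F where "has_fourier_transform f F" and "AE \<xi> in lborel. \<xi> \<notin> {-\<Omega>/2..\<Omega>/2} \<longrightarrow> F \<xi> = 0"
  using assms unfolding PW_def by blast

lemma PW_continuous: "f \<in> PW \<Omega> \<Longrightarrow> continuous_on UNIV f"
  unfolding PW_def by blast

lemma PW_I:
  assumes "continuous_on UNIV f" and "has_fourier_transform f F"
    and "AE \<xi> in lborel. \<xi> \<notin> {-\<Omega>/2..\<Omega>/2} \<longrightarrow> F \<xi> = 0"
  shows "f \<in> PW \<Omega>"
  using assms unfolding PW_def has_fourier_transform_def by blast

lemma PW_add:
  assumes f: "f \<in> PW \<Omega>" and g: "g \<in> PW \<Omega>"
  shows "(\<lambda>t. f t + g t) \<in> PW \<Omega>"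
proof -
  obtain F where F: "has_fourier_transform f F" "AE \<xi> in lborel. \<xi> \<notin> {-\<Omega>/2..\<Omega>/2} \<longrightarrow> F \<xi> = 0"
    using f by (rule PW_obtain_transform)
  obtain G where G: "has_fourier_transform g G" "AE \<xi> in lborel. \<xi> \<notin> {-\<Omega>/2..\<Omega>/2} \<longrightarrow> G \<xi> = 0"
    using g by (rule PW_obtain_transform)
  have "AE \<xi> in lborel. \<xi> \<notin> {-\<Omega>/2..\<Omega>/2} \<longrightarrow> F \<xi> + G \<xi> = 0"
    using F(2) G(2) by eventually_elim auto
  then show ?thesis
    by (rule PW_I[OF continuous_on_add[OF PW_continuous[OF f] PW_continuous[OF g]]
          has_fourier_transform_add[OF F(1) G(1)]])
qed

lemma tame_diff:
  assumes "tame u" and "tame v"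
  shows "tame (\<lambda>t. u t - v t)"
proof -
  obtain A B where "\<And>t. cmod (u t) \<le> A" "\<And>t. cmod (v t) \<le> B"
    using assms by (auto simp: tame_def)
  then have "\<exists>C. \<forall>t. cmod (u t - v t) \<le> C"
    by (intro exI[of _ "A + B"] allI norm_triangle_le_diff add_mono)
  moreover have "AE t in lborel. isCont u t" "AE t in lborel. isCont v t"
    using assms by (auto simp: tame_def)
  then have "AE t in lborel. isCont (\<lambda>t. u t - v t) t"
    by eventually_elim (intro continuous_intros)
  ultimately show ?thesis using assms by (auto simp: tame_def)
qed

text \<open>
  Only the two endpoints can be points of discontinuity.
\<close>

lemma tame_truncation:
  assumes f: "continuous_on UNIV f"
  shows "tame (\<lambda>t. indicator {a..b} t * f t)"
proof -
  have i: "integrable lborel (\<lambda>t. indicator {a..b} t * f t)"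
    using borel_integrable_compact[of "{a..b}" f] continuous_on_subset[OF f]
    by (simp add: scaleR_conv_of_real of_real_indicator)
  have "bounded (f ` {a..b})"
    by (intro compact_imp_bounded compact_continuous_image continuous_on_subset[OF f]) auto
  then obtain B where B: "\<And>t. t \<in> {a..b} \<Longrightarrow> cmod (f t) \<le> B"
    unfolding bounded_iff by (meson imageI)
  have "\<exists>B. \<forall>t. cmod (indicator {a..b} t * f t) \<le> B"
    by (intro exI[of _ "max B 0"]) (auto simp: indicator_def le_max_iff_disj B)
  moreover have "AE t in lborel. isCont (\<lambda>t. indicator {a..b} t * f t) t"
    using AE_lborel_singleton[of a] AE_lborel_singleton[of b]
  proof eventually_elim
    case (elim t)
    have ft: "isCont f t" using f by (simp add: continuous_on_eq_continuous_at)
    have "isCont (\<lambda>t. complex_of_real (indicator {a..b} t)) t"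
      using elim by (intro isCont_of_real isCont_indicator[THEN iffD2]) (auto simp: frontier_def)
    then have "isCont (indicator {a..b} :: real \<Rightarrow> complex) t"
      by (simp add: of_real_indicator)
    then show ?case by (intro continuous_intros ft)
  qed
  ultimately show ?thesis using i by (simp add: tame_def)
qed

text \<open>
  By Plancherel's theorem the mean-square error of the truncated transforms equals the mean square of the tail
  of \<open>u\<close>.
\<close>

theorem tame_in_PW:
  assumes u: "tame u" and cont: "continuous_on UNIV u"
    and band: "\<And>\<xi>. \<xi> \<notin> {-\<Omega>/2..\<Omega>/2} \<Longrightarrow> fourier_integral u \<xi> = 0"
  shows "u \<in> PW \<Omega>"
proof -
  have iu: "integrable lborel u" using u by (simp add: tame_def)
  then have [measurable]: "u \<in> borel_measurable borel" by auto
  define r where "r = (\<lambda>R t. u t - indicator {-R..R} t * u t)"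
  have tr: "tame (\<lambda>t. indicator {-R..R} t * u t)" for R by (rule tame_truncation[OF cont])
  have r: "tame (r R)" for R unfolding r_def by (rule tame_diff[OF u tr])
  have "fourier_integral (r R) \<xi> = fourier_integral u \<xi> - fourier_integral (\<lambda>t. indicator {-R..R} t * u t) \<xi>" for R \<xi>
    unfolding r_def using iu tr by (intro fourier_integral_diff) (auto simp: tame_def)
  then have "(\<integral>\<^sup>+ \<xi>. ennreal ((cmod (fourier_integral (\<lambda>t. indicator {-R..R} t * u t) \<xi> - fourier_integral u \<xi>))\<^sup>2) \<partial>lborel)
      = (\<integral>\<^sup>+ \<xi>. ennreal ((cmod (fourier_integral (r R) \<xi>))\<^sup>2) \<partial>lborel)" for R
    by (simp add: norm_minus_commute)
  also have "\<dots> R = ennreal (LINT t|lborel. (cmod (r R t))\<^sup>2)" for R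
    unfolding plancherel_tame(2)[OF r, symmetric]
    by (rule nn_integral_eq_integral) (use plancherel_tame(1)[OF r] in \<open>auto simp: square_integrable_def\<close>)
  finally have E: "(\<integral>\<^sup>+ \<xi>. ennreal ((cmod (fourier_integral (\<lambda>t. indicator {-R..R} t * u t) \<xi> - fourier_integral u \<xi>))\<^sup>2) \<partial>lborel)
      = ennreal (LINT t|lborel. (cmod (r R t))\<^sup>2)" for R .
  have "((\<lambda>R. LINT t|lborel. (cmod (r R t))\<^sup>2) \<longlongrightarrow> (LINT t::real|lborel. 0)) at_top"
  proof (rule integral_dominated_convergence_at_top[where w="\<lambda>t. (cmod (u t))\<^sup>2"])
    show "integrable lborel (\<lambda>t. (cmod (u t))\<^sup>2)"
      using tame_square_integrable[OF u] by (simp add: square_integrable_def)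
    show "\<forall>\<^sub>F R in at_top. AE t in lborel. norm ((cmod (r R t))\<^sup>2) \<le> (cmod (u t))\<^sup>2"
      by (intro always_eventually allI AE_I2) (simp add: r_def indicator_def)
    show "AE t in lborel. ((\<lambda>R. (cmod (r R t))\<^sup>2) \<longlongrightarrow> 0) at_top"
    proof (rule AE_I2)
      fix t :: real
      have "\<forall>\<^sub>F R in at_top. (cmod (r R t))\<^sup>2 = 0"
        using eventually_ge_at_top[of "\<bar>t\<bar>"] by eventually_elim (auto simp: r_def indicator_def)
      then show "((\<lambda>R. (cmod (r R t))\<^sup>2) \<longlongrightarrow> 0) at_top" by (rule tendsto_eventually)
    qed
  qed (auto simp: r_def)
  then have "((\<lambda>R. ennreal (LINT t|lborel. (cmod (r R t))\<^sup>2)) \<longlongrightarrow> 0) at_top"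
    by (auto dest: tendsto_ennrealI)
  then have "has_fourier_transform u (fourier_integral u)"
    unfolding has_fourier_transform_def E
    using tame_square_integrable[OF u] plancherel_tame(1)[OF u] by (intro conjI)
  then show ?thesis
    by (rule PW_I[OF cont _ AE_I2]) (intro impI band)
qed

lemma integral_indicator_Icc:
  fixes a b :: real
  assumes "a \<le> b"
  shows "(LINT t|lborel. (cmod (indicator {a..b} t))\<^sup>2) = b - a"
proof -
  have "(\<lambda>t. (cmod (indicator {a..b} t))\<^sup>2) = (indicator {a..b} :: real \<Rightarrow> real)"
    by (auto simp: indicator_def)
  then show ?thesis using assms by simp
qed

lemma indicator_mult_eq_of_support:
  fixes F :: "real \<Rightarrow> complex"
  assumes "\<And>\<xi>. \<xi> \<notin> A \<Longrightarrow> F \<xi> = 0"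
  shows "(\<lambda>\<xi>. indicator A \<xi> * F \<xi>) = F"
proof
  show "indicator A \<xi> * F \<xi> = F \<xi>" for \<xi>
    by (cases "\<xi> \<in> A") (simp_all add: assms)
qed

lemma integrable_of_bounded_support:
  assumes F: "square_integrable F" and band: "\<And>\<xi>. \<xi> \<notin> {a..b} \<Longrightarrow> F \<xi> = 0"
  shows "integrable lborel F"
proof -
  have "(\<lambda>\<xi>. indicator {a..b} \<xi> * F \<xi>) = F"
    by (rule indicator_mult_eq_of_support[OF band])
  with integrable_indicator_mult[OF F, of a b] show ?thesis by simp
qed

lemma norm_integral_band_le:
  assumes F: "square_integrable F" and band: "\<And>\<xi>. \<xi> \<notin> {a..b} \<Longrightarrow> F \<xi> = 0" and "a \<le> b"
  shows "(cmod (LINT \<xi>|lborel. F \<xi>))\<^sup>2 \<le> (b - a) * (LINT \<xi>|lborel. (cmod (F \<xi>))\<^sup>2)"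
proof -
  have eq: "(\<lambda>\<xi>. indicator {a..b} \<xi> * F \<xi>) = F"
    by (rule indicator_mult_eq_of_support[OF band])
  have "(cmod (LINT \<xi>|lborel. F \<xi>))\<^sup>2 \<le> (LINT \<xi>|lborel. cmod (F \<xi>))\<^sup>2"
    by (intro power_mono integral_norm_bound) simp
  also have "\<dots> \<le> (LINT \<xi>|lborel. (cmod (indicator {a..b} \<xi>))\<^sup>2) * (LINT \<xi>|lborel. (cmod (F \<xi>))\<^sup>2)"
    using integral_Cauchy_Schwarz(2)[OF square_integrable_indicator[of a b] F] unfolding fun_cong[OF eq] .
  finally show ?thesis unfolding integral_indicator_Icc[OF \<open>a \<le> b\<close>] .
qed

text \<open>
  Gaussian summation at the point \<open>s\<close> gives the inversion formula for \<open>u s\<close>, because the transform vanishes outside a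
  bounded interval and is therefore integrable. Cauchy--Schwarz over the band and Plancherel's theorem
  turn it into the bound.
\<close>

theorem band_limited_pointwise_bound:
  assumes u: "tame u" and cont: "continuous_on UNIV u" and "\<Omega> \<ge> 0"
    and band: "\<And>\<xi>. \<xi> \<notin> {-\<Omega>/2..\<Omega>/2} \<Longrightarrow> fourier_integral u \<xi> = 0"
  shows "(cmod (u s))\<^sup>2 \<le> \<Omega> * (LINT t|lborel. (cmod (u t))\<^sup>2)"
proof -
  have iu: "integrable lborel u" using u by (simp add: tame_def)
  then have [measurable]: "u \<in> borel_measurable borel" by auto
  obtain B where B: "\<And>t. cmod (u t) \<le> B" using u unfolding tame_def by blast
  let ?F = "fourier_integral u"
  have F: "square_integrable ?F" by (rule plancherel_tame(1)[OF u])
  then have [measurable]: "?F \<in> borel_measurable borel" by (simp add: square_integrable_def)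
  define G where "G = (\<lambda>\<xi>. ?F \<xi> * cis (2 * pi * s * \<xi>))"
  have G: "square_integrable G" unfolding G_def by (rule square_integrable_mult_cis[OF F]) measurable
  have Gb: "\<xi> \<notin> {-\<Omega>/2..\<Omega>/2} \<Longrightarrow> G \<xi> = 0" for \<xi> by (simp add: G_def band)
  have iG: "integrable lborel G" by (rule integrable_of_bounded_support[OF G Gb])
  have e0: "(\<lambda>i. 1 / real (Suc i)) \<longlonglongrightarrow> 0" by (intro LIMSEQ_Suc lim_inverse_n')
  have "(\<lambda>i. LINT \<xi>|lborel. ?F \<xi> * (complex_of_real (exp (- (1 / real (Suc i) * \<xi>)\<^sup>2 / 2)) * cis (2 * pi * s * \<xi>)))
      \<longlonglongrightarrow> (LINT \<xi>|lborel. G \<xi>)"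
  proof (rule integral_dominated_convergence[where w="\<lambda>\<xi>. cmod (G \<xi>)"])
    show "AE \<xi> in lborel. (\<lambda>i. ?F \<xi> * (complex_of_real (exp (- (1 / real (Suc i) * \<xi>)\<^sup>2 / 2)) * cis (2 * pi * s * \<xi>)))
        \<longlonglongrightarrow> G \<xi>"
    proof (rule AE_I2)
      fix \<xi>
      have "(\<lambda>i. ?F \<xi> * (complex_of_real (exp (- (1 / real (Suc i) * \<xi>)\<^sup>2 / 2)) * cis (2 * pi * s * \<xi>)))
         \<longlonglongrightarrow> ?F \<xi> * (complex_of_real (exp (- (0 * \<xi>)\<^sup>2 / 2)) * cis (2 * pi * s * \<xi>))"
        using e0 by (intro tendsto_intros) auto
      then show "(\<lambda>i. ?F \<xi> * (complex_of_real (exp (- (1 / real (Suc i) * \<xi>)\<^sup>2 / 2)) * cis (2 * pi * s * \<xi>)))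
        \<longlonglongrightarrow> G \<xi>" by (simp add: G_def)
    qed
    show "AE \<xi> in lborel. cmod (?F \<xi> * (complex_of_real (exp (- (1 / real (Suc i) * \<xi>)\<^sup>2 / 2)) * cis (2 * pi * s * \<xi>))) \<le> cmod (G \<xi>)" for i
      by (intro AE_I2) (simp add: norm_mult G_def mult_left_le)
    show "G \<in> borel_measurable lborel" unfolding G_def by measurable
    show "integrable lborel (\<lambda>\<xi>. cmod (G \<xi>))" using iG by simp
  qed measurable
  moreover have "(\<lambda>i. gaussian_mean (1 / real (Suc i)) u s) \<longlonglongrightarrow> u s"
    using cont by (intro tendsto_gaussian_mean[OF B _ _ e0]) (auto simp: continuous_on_eq_continuous_at)
  ultimately have "u s = (LINT \<xi>|lborel. G \<xi>)"
    by (subst (asm) gaussian_summation[OF iu]) (auto dest: LIMSEQ_unique)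
  then have "(cmod (u s))\<^sup>2 \<le> (\<Omega> / 2 - (- \<Omega> / 2)) * (LINT \<xi>|lborel. (cmod (G \<xi>))\<^sup>2)"
    using \<open>\<Omega> \<ge> 0\<close> by (simp only:) (intro norm_integral_band_le[OF G Gb], simp_all)
  also have "(LINT \<xi>|lborel. (cmod (G \<xi>))\<^sup>2) = (LINT t|lborel. (cmod (u t))\<^sup>2)"
    using plancherel_tame(2)[OF u] by (simp add: G_def norm_mult)
  finally show ?thesis by simp
qed

text \<open>
  The fundamental theorem of calculus: \<open>D t\<close> is the derivative of an indefinite integral that vanishes identically.
\<close>

lemma continuous_eq_0_of_integrals_eq_0:
  fixes D :: "real \<Rightarrow> complex"
  assumes cont: "continuous_on UNIV D"
    and zero: "\<And>a b. a \<le> b \<Longrightarrow> (LINT t|lborel. indicator {a..b} t * D t) = 0"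
  shows "D t = 0"
proof -
  have Z: "integral {t - 1..x} D = 0" if "x \<in> cbox (t - 1) (t + 1)" for x
  proof -
    have "set_integrable lborel {t - 1..x} D"
      unfolding set_integrable_def
      by (intro borel_integrable_compact continuous_on_subset[OF cont]) auto
    from set_borel_integral_eq_integral(2)[OF this]
    have "integral {t - 1..x} D = (LINT s|lborel. indicator {t - 1..x} s *\<^sub>R D s)"
      unfolding set_lebesgue_integral_def by (rule sym)
    also have "\<dots> = (LINT s|lborel. indicator {t - 1..x} s * D s)"
      by (simp add: scaleR_conv_of_real of_real_indicator)
    also have "\<dots> = 0" using that by (intro zero) auto
    finally show ?thesis .
  qed
  have dv: "((\<lambda>x. integral {t - 1..x} D) has_vector_derivative D t) (at t within cbox (t - 1) (t + 1))"
    unfolding cbox_interval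
    by (intro integral_has_vector_derivative continuous_on_subset[OF cont]) auto
  have "((\<lambda>x. 0) has_vector_derivative D t) (at t within cbox (t - 1) (t + 1))"
    by (rule has_vector_derivative_transform[OF _ Z[symmetric] dv]) auto
  moreover have "((\<lambda>x. 0) has_vector_derivative 0) (at t within cbox (t - 1) (t + 1))"
    by (rule has_vector_derivative_const)
  ultimately show ?thesis
    by (rule vector_derivative_unique_within_closed_interval[rotated 2]) auto
qed

text \<open>
  An element of the Paley--Wiener space need not be integrable, so \<open>f\<close> is compared with the candidate \<open>f'\<close> given by the
  inversion integral through their integrals over bounded intervals. For a truncation of \<open>f\<close>, the integral over \<open>{a..b}\<close>
  is by Parseval's identity an inner product with the transform of the indicator of \<open>{a..b}\<close>. This
  passes to the mean-square limit \<open>F\<close>, and Fubini's theorem identifies the result with the integral of \<open>f'\<close>. Both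
  functions are continuous, so they agree everywhere.
\<close>

theorem PW_inversion:
  assumes f: "f \<in> PW \<Omega>"
  obtains F where "square_integrable F" and "\<And>\<xi>. \<xi> \<notin> {-\<Omega>/2..\<Omega>/2} \<Longrightarrow> F \<xi> = 0"
    and "\<And>t. f t = (LINT \<xi>|lborel. F \<xi> * cis (2 * pi * t * \<xi>))"
proof -
  obtain F0 where F0: "has_fourier_transform f F0" and ae: "AE \<xi> in lborel. \<xi> \<notin> {-\<Omega>/2..\<Omega>/2} \<longrightarrow> F0 \<xi> = 0"
    using f by (rule PW_obtain_transform)
  have cont: "continuous_on UNIV f" using f by (rule PW_continuous)
  have sF0: "square_integrable F0" and lim0: "((\<lambda>R. \<integral>\<^sup>+ \<xi>. ennreal ((cmod (fourier_integral (\<lambda>t. indicator {-R..R} t * f t) \<xi> - F0 \<xi>))\<^sup>2) \<partial>lborel)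
        \<longlongrightarrow> 0) at_top"
    using F0 unfolding has_fourier_transform_def by (rule conjunct2[THEN conjunct1], rule conjunct2[THEN conjunct2])
  have [measurable]: "F0 \<in> borel_measurable borel" using sF0 by (simp add: square_integrable_def)
  \<comment> \<open>Changing \<open>F0\<close> on a null set makes it vanish everywhere outside the band.\<close>
  define F where "F = (\<lambda>\<xi>. indicator {-\<Omega>/2..\<Omega>/2} \<xi> * F0 \<xi>)"
  have [measurable]: "F \<in> borel_measurable borel" unfolding F_def by measurable
  have Fb: "F \<xi> = 0" if "\<xi> \<notin> {-\<Omega>/2..\<Omega>/2}" for \<xi> using that by (simp add: F_def)
  have aeF: "AE \<xi> in lborel. F0 \<xi> = F \<xi>"
    using ae by eventually_elim (auto simp: F_def indicator_def)
  have sF: "square_integrable F"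
    unfolding F_def by (rule square_integrable_indicator_mult[OF sF0])
  have iF: "integrable lborel F" by (rule integrable_of_bounded_support[OF sF Fb])
  define fR where "fR = (\<lambda>R t. indicator {-R..R} t * f t)"
  have tfR: "tame (fR R)" for R unfolding fR_def by (rule tame_truncation[OF cont])
  have sd: "square_integrable (\<lambda>\<xi>. fourier_integral (fR R) \<xi> - F \<xi>)" for R
    by (intro square_integrable_diff plancherel_tame(1) tfR sF)
  have "((\<lambda>R. ennreal (LINT \<xi>|lborel. (cmod (fourier_integral (fR R) \<xi> - F \<xi>))\<^sup>2)) \<longlongrightarrow> 0) at_top"
  proof -
    have "(\<integral>\<^sup>+ \<xi>. ennreal ((cmod (fourier_integral (\<lambda>t. indicator {-R..R} t * f t) \<xi> - F0 \<xi>))\<^sup>2) \<partial>lborel)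
        = (\<integral>\<^sup>+ \<xi>. ennreal ((cmod (fourier_integral (fR R) \<xi> - F \<xi>))\<^sup>2) \<partial>lborel)" for R
    proof (rule nn_integral_cong_AE)
      show "AE \<xi> in lborel. ennreal ((cmod (fourier_integral (\<lambda>t. indicator {-R..R} t * f t) \<xi> - F0 \<xi>))\<^sup>2)
          = ennreal ((cmod (fourier_integral (fR R) \<xi> - F \<xi>))\<^sup>2)"
        using aeF by eventually_elim (simp add: fR_def)
    qed
    also have "\<dots> R = ennreal (LINT \<xi>|lborel. (cmod (fourier_integral (fR R) \<xi> - F \<xi>))\<^sup>2)" for R
      by (rule nn_integral_eq_integral[OF square_integrableD(2)[OF sd]]) simp
    finally show ?thesis using lim0 by (simp only:)
  qed
  then have lim: "((\<lambda>R. LINT \<xi>|lborel. (cmod (fourier_integral (fR R) \<xi> - F \<xi>))\<^sup>2) \<longlongrightarrow> 0) at_top"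
    unfolding ennreal_0[symmetric] by (rule tendsto_ennrealD) auto
  define f' where "f' = (\<lambda>t. LINT \<xi>|lborel. F \<xi> * cis (2 * pi * t * \<xi>))"
  have f'_eq: "f' t = fourier_integral F (- t)" for t
    by (simp add: f'_def fourier_integral_cis mult_ac)
  have contf': "continuous_on UNIV f'"
    unfolding f'_eq[abs_def]
    by (rule continuous_on_compose2[OF continuous_fourier_integral[OF iF]]) (auto intro: continuous_intros)
  have "(LINT t|lborel. indicator {a..b} t * (f t - f' t)) = 0" if "a \<le> b" for a b
  proof -
    define v where "v = (indicator {a..b} :: real \<Rightarrow> complex)"
    let ?V = "fourier_integral v"
    have tv: "tame v"
      using tame_truncation[of "\<lambda>_. 1" a b] by (simp add: v_def continuous_on_const)
    then have iv: "integrable lborel v" by (simp add: tame_def)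
    have sV: "square_integrable (\<lambda>\<xi>. cnj (?V \<xi>))"
      by (intro square_integrable_cnj plancherel_tame(1) tv)
    have iFV: "integrable lborel (\<lambda>\<xi>. F \<xi> * cnj (?V \<xi>))"
      by (rule integral_Cauchy_Schwarz(1)[OF sF sV])
    have bound: "norm ((LINT \<xi>|lborel. fourier_integral (fR R) \<xi> * cnj (?V \<xi>)) - (LINT \<xi>|lborel. F \<xi> * cnj (?V \<xi>)))
        \<le> sqrt ((LINT \<xi>|lborel. (cmod (fourier_integral (fR R) \<xi> - F \<xi>))\<^sup>2) * (LINT \<xi>|lborel. (cmod (cnj (?V \<xi>)))\<^sup>2))" for R
    proof (rule real_le_rsqrt)
      have "(LINT \<xi>|lborel. fourier_integral (fR R) \<xi> * cnj (?V \<xi>)) - (LINT \<xi>|lborel. F \<xi> * cnj (?V \<xi>))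
         = (LINT \<xi>|lborel. (fourier_integral (fR R) \<xi> - F \<xi>) * cnj (?V \<xi>))"
        unfolding left_diff_distrib
        by (rule Bochner_Integration.integral_diff[symmetric, OF integral_Cauchy_Schwarz(1)[OF plancherel_tame(1)[OF tfR] sV] iFV])
      then have "(cmod ((LINT \<xi>|lborel. fourier_integral (fR R) \<xi> * cnj (?V \<xi>)) - (LINT \<xi>|lborel. F \<xi> * cnj (?V \<xi>))))\<^sup>2
         \<le> (LINT \<xi>|lborel. cmod ((fourier_integral (fR R) \<xi> - F \<xi>) * cnj (?V \<xi>)))\<^sup>2"
        by (simp only:) (intro power_mono integral_norm_bound norm_ge_zero)
      also note integral_Cauchy_Schwarz(2)[OF sd sV]
      finally show "(cmod ((LINT \<xi>|lborel. fourier_integral (fR R) \<xi> * cnj (?V \<xi>)) - (LINT \<xi>|lborel. F \<xi> * cnj (?V \<xi>))))\<^sup>2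
         \<le> (LINT \<xi>|lborel. (cmod (fourier_integral (fR R) \<xi> - F \<xi>))\<^sup>2) * (LINT \<xi>|lborel. (cmod (cnj (?V \<xi>)))\<^sup>2)" .
    qed
    have "((\<lambda>R. sqrt ((LINT \<xi>|lborel. (cmod (fourier_integral (fR R) \<xi> - F \<xi>))\<^sup>2) * (LINT \<xi>|lborel. (cmod (cnj (?V \<xi>)))\<^sup>2))) \<longlongrightarrow> sqrt (0 * (LINT \<xi>|lborel. (cmod (cnj (?V \<xi>)))\<^sup>2))) at_top"
      by (intro tendsto_real_sqrt tendsto_mult lim tendsto_const)
    then have "((\<lambda>R. (LINT \<xi>|lborel. fourier_integral (fR R) \<xi> * cnj (?V \<xi>)) - (LINT \<xi>|lborel. F \<xi> * cnj (?V \<xi>))) \<longlongrightarrow> 0) at_top"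
      by (intro Lim_null_comparison[OF always_eventually[OF allI[OF bound]]]) simp
    then have limV: "((\<lambda>R. LINT \<xi>|lborel. fourier_integral (fR R) \<xi> * cnj (?V \<xi>)) \<longlongrightarrow> (LINT \<xi>|lborel. F \<xi> * cnj (?V \<xi>))) at_top"
      by (simp add: LIM_zero_iff)
    have "\<forall>\<^sub>F R in at_top. (LINT \<xi>|lborel. fourier_integral (fR R) \<xi> * cnj (?V \<xi>)) = (LINT t|lborel. indicator {a..b} t * f t)"
      using eventually_ge_at_top[of "max \<bar>a\<bar> \<bar>b\<bar>"]
    proof eventually_elim
      case (elim R)
      have "(LINT \<xi>|lborel. fourier_integral (fR R) \<xi> * cnj (?V \<xi>)) = (LINT t|lborel. fR R t * cnj (v t))"
        by (rule parseval_tame[OF tfR tv])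
      also have "\<dots> = (LINT t|lborel. indicator {a..b} t * f t)"
        using elim by (intro Bochner_Integration.integral_cong) (auto simp: fR_def v_def indicator_def)
      finally show ?case .
    qed
    from tendsto_unique[OF trivial_limit_at_top_linorder tendsto_eventually[OF this] limV]
    have "(LINT t|lborel. indicator {a..b} t * f t) = (LINT \<xi>|lborel. F \<xi> * cnj (?V \<xi>))" .
    also have "\<dots> = (LINT \<xi>|lborel. F \<xi> * (LINT t|lborel. v t * cis (2 * pi * t * \<xi>)))"
    proof -
      have "cnj (?V \<xi>) = (LINT t|lborel. cnj (v t * cis (- (2 * pi * t * \<xi>))))" for \<xi>
        unfolding fourier_integral_cis by (rule Bochner_Integration.integral_cnj[symmetric])
      also have "\<dots> \<xi> = (LINT t|lborel. v t * cis (2 * pi * t * \<xi>))" for \<xi>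
        by (intro Bochner_Integration.integral_cong) (auto simp: v_def indicator_def cis_cnj)
      finally show ?thesis by simp
    qed
    also have "\<dots> = (LINT t|lborel. v t * (LINT \<xi>|lborel. F \<xi> * cis (2 * pi * t * \<xi>)))"
      by (rule integral_swap_kernel[OF iv iF]) auto
    finally have eq: "(LINT t|lborel. indicator {a..b} t * f t) = (LINT t|lborel. indicator {a..b} t * f' t)"
      by (simp add: v_def f'_def)
    have "integrable lborel (\<lambda>t. indicator {a..b} t * f t)" "integrable lborel (\<lambda>t. indicator {a..b} t * f' t)"
      using tame_truncation[OF cont] tame_truncation[OF contf'] by (auto simp: tame_def)
    with eq show ?thesis by (simp add: right_diff_distrib)
  qed
  then have "f t - f' t = 0" for t
    by (rule continuous_eq_0_of_integrals_eq_0[OF continuous_on_diff[OF cont contf']])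
  then show ?thesis
    by (intro that[OF sF Fb]) (simp_all add: f'_def)
qed

section \<open>Samples of Paley--Wiener functions\<close>

text \<open>
  This serves twice: as orthogonality of exponentials over whole periods, and as the representation of sinc
  as a superposition of exponentials.
\<close>

lemma integral_cis_symmetric_interval:
  assumes "L \<ge> 0"
  shows "(LINT y|lborel. indicator {-L..L} y *\<^sub>R cis (x * y)) = complex_of_real (2 * L * sinc (x * L))"
proof (cases "x = 0")
  case True
  have "(LINT y|lborel. indicator {-L..L} y *\<^sub>R (1::complex)) = of_real L - of_real (- L)"
    using assms by (intro integral_FTC_atLeastAtMost[where F=complex_of_real and f="\<lambda>_. 1"])
      (auto intro!: has_vector_derivative_of_real derivative_eq_intros)
  then show ?thesis using True by simp
next
  case False
  define c where "c = \<i> * of_real x"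
  have "c \<noteq> 0" using False by (simp add: c_def)
  have cis: "cis (x * y) = exp (c * of_real y)" for y
    by (simp add: cis_conv_exp c_def mult_ac)
  have "(LINT y|lborel. indicator {-L..L} y *\<^sub>R exp (c * of_real y))
      = exp (c * of_real L) / c - exp (c * of_real (- L)) / c"
  proof (rule integral_FTC_atLeastAtMost)
    show "((\<lambda>y. exp (c * of_real y) / c) has_vector_derivative exp (c * of_real y)) (at y within {- L..L})" for y
      using \<open>c \<noteq> 0\<close> by (auto intro!: derivative_eq_intros has_vector_derivative_real_field)
    show "continuous_on {- L..L} (\<lambda>x. exp (c * of_real x))" by (intro continuous_intros)
  qed (use assms in simp)
  also have "\<dots> = (cis (x * L) - cis (- (x * L))) / c"
    using cis[of L] cis[of "- L"] by (simp add: diff_divide_distrib)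
  also have "\<dots> = complex_of_real (2 * (sin (x * L) / x))"
  proof -
    have "cis (x * L) - cis (- (x * L)) = 2 * \<i> * of_real (sin (x * L))" by (simp add: complex_eq_iff)
    then show ?thesis using False by (simp add: c_def)
  qed
  also have "2 * (sin (x * L) / x) = 2 * L * sinc (x * L)"
    using False by simp
  finally show ?thesis by (simp only: cis)
qed

lemma integral_cis_periods:
  fixes n :: int and m :: nat
  assumes "\<alpha> > 0" and L: "L = real m / \<alpha>"
  shows "(LINT \<xi>|lborel. indicator {-L..L} \<xi> *\<^sub>R cis (2 * pi * (\<alpha> * of_int n) * \<xi>)) = (if n = 0 then of_real (2 * L) else 0)"
proof -
  have "L \<ge> 0" and aL: "\<alpha> * L = real m" using assms by simp_all
  have "2 * pi * (\<alpha> * of_int n) * L = 2 * pi * (of_int n * (\<alpha> * L))" by (simp only: mult_ac)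
  also have "\<dots> = of_int (2 * n * int m) * pi" by (simp add: aL)
  finally have "sin (2 * pi * (\<alpha> * of_int n) * L) = 0" by (simp only: sin_zero_iff_int2) blast
  then show ?thesis
    unfolding integral_cis_symmetric_interval[OF \<open>L \<ge> 0\<close>] using \<open>\<alpha> > 0\<close> by auto
qed

text \<open>
  The exponentials with frequencies in \<open>\<alpha> \<int>\<close> are orthogonal on every interval made of whole
  periods, here \<open>{-L..L}\<close> with \<open>2 m\<close> periods of length \<open>1 / \<alpha>\<close>. So the whole band is treated at once even when it is longer than
  one period. The inequality is proved by duality: the sum is the
  inner product of \<open>F\<close> with the trigonometric polynomial that has the coefficients \<open>cnj (c k)\<close>.
\<close>

lemma bessel_samples:
  fixes K :: "int set" and m :: nat
  assumes F: "square_integrable F" and band: "\<And>\<xi>. \<xi> \<notin> {-L..L} \<Longrightarrow> F \<xi> = 0"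
    and "\<alpha> > 0" and L: "L = real m / \<alpha>" and "finite K"
  defines "c \<equiv> \<lambda>k::int. LINT \<xi>|lborel. F \<xi> * cis (2 * pi * (\<alpha> * of_int k) * \<xi>)"
  shows "(\<Sum>k\<in>K. (cmod (c k))\<^sup>2) \<le> 2 * L * (LINT \<xi>|lborel. (cmod (F \<xi>))\<^sup>2)"
proof -
  let ?e = "\<lambda>k::int. \<lambda>\<xi>. cis (2 * pi * (\<alpha> * of_int k) * \<xi>)"
  define S where "S = (\<Sum>k\<in>K. (cmod (c k))\<^sup>2)"
  define Q where "Q = (\<lambda>\<xi>. \<Sum>k\<in>K. cnj (c k) * ?e k \<xi>)"
  define P where "P = (\<lambda>\<xi>. indicator {-L..L} \<xi> * Q \<xi>)"
  have Sc: "complex_of_real S = (\<Sum>k\<in>K. cnj (c k) * c k)"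
    unfolding S_def by (simp only: of_real_sum complex_norm_square mult.commute)
  have P: "square_integrable P"
    unfolding P_def Q_def
    by (intro tame_square_integrable tame_truncation continuous_intros)
  have iF: "integrable lborel (\<lambda>\<xi>. F \<xi> * ?e k \<xi>)" for k
    by (intro integrable_mult_cis integrable_of_bounded_support[OF F band]) auto
  have "F \<xi> * P \<xi> = (\<Sum>k\<in>K. cnj (c k) * (F \<xi> * ?e k \<xi>))" for \<xi>
  proof -
    have "F \<xi> * P \<xi> = (indicator {-L..L} \<xi> * F \<xi>) * Q \<xi>" by (simp add: P_def)
    also have "indicator {-L..L} \<xi> * F \<xi> = F \<xi>"
      by (rule fun_cong[OF indicator_mult_eq_of_support[OF band]])
    also have "F \<xi> * Q \<xi> = (\<Sum>k\<in>K. cnj (c k) * (F \<xi> * ?e k \<xi>))"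
      unfolding Q_def by (simp add: sum_distrib_left mult_ac)
    finally show ?thesis .
  qed
  then have "(LINT \<xi>|lborel. F \<xi> * P \<xi>) = complex_of_real S"
    using iF unfolding Sc by (simp add: Bochner_Integration.integral_sum c_def)
  moreover have "S \<ge> 0" unfolding S_def by (intro sum_nonneg) simp
  ultimately have "S = cmod (LINT \<xi>|lborel. F \<xi> * P \<xi>)" by simp
  also have "\<dots> \<le> (LINT \<xi>|lborel. cmod (F \<xi> * P \<xi>))" by (rule integral_norm_bound)
  finally have "S\<^sup>2 \<le> (LINT \<xi>|lborel. cmod (F \<xi> * P \<xi>))\<^sup>2" using \<open>S \<ge> 0\<close> by (intro power_mono)
  also have "\<dots> \<le> (LINT \<xi>|lborel. (cmod (F \<xi>))\<^sup>2) * (LINT \<xi>|lborel. (cmod (P \<xi>))\<^sup>2)"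
    by (rule integral_Cauchy_Schwarz(2)[OF F P])
  also have "(LINT \<xi>|lborel. (cmod (P \<xi>))\<^sup>2) = 2 * L * S"
  proof -
    have ie: "integrable lborel (\<lambda>\<xi>. indicator {-L..L} \<xi> *\<^sub>R ?e k \<xi>)" for k
      by (intro borel_integrable_compact continuous_intros) auto
    have "complex_of_real ((cmod (P \<xi>))\<^sup>2) = (\<Sum>k\<in>K. \<Sum>l\<in>K. cnj (c k) * c l * (indicator {-L..L} \<xi> *\<^sub>R ?e (k - l) \<xi>))" for \<xi>
    proof -
      have "complex_of_real ((cmod (P \<xi>))\<^sup>2) = indicator {-L..L} \<xi> *\<^sub>R (Q \<xi> * cnj (Q \<xi>))"
        unfolding complex_norm_square P_def by (simp add: indicator_def)
      also have "\<dots> = indicator {-L..L} \<xi> *\<^sub>R (\<Sum>k\<in>K. \<Sum>l\<in>K. (cnj (c k) * ?e k \<xi>) * (c l * cnj (?e l \<xi>)))"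
        unfolding Q_def by (simp add: sum_product)
      also have "\<dots> = (\<Sum>k\<in>K. \<Sum>l\<in>K. indicator {-L..L} \<xi> *\<^sub>R ((cnj (c k) * ?e k \<xi>) * (c l * cnj (?e l \<xi>))))"
        by (simp only: scaleR_sum_right)
      also have "\<dots> = (\<Sum>k\<in>K. \<Sum>l\<in>K. cnj (c k) * c l * (indicator {-L..L} \<xi> *\<^sub>R ?e (k - l) \<xi>))"
      proof (intro sum.cong refl)
        fix k l
        have "?e k \<xi> * cnj (?e l \<xi>) = ?e (k - l) \<xi>"
          by (simp add: cis_cnj cis_mult algebra_simps)
        then show "indicator {-L..L} \<xi> *\<^sub>R ((cnj (c k) * ?e k \<xi>) * (c l * cnj (?e l \<xi>)))
            = cnj (c k) * c l * (indicator {-L..L} \<xi> *\<^sub>R ?e (k - l) \<xi>)"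
          by (simp add: mult_ac flip: \<open>?e k \<xi> * cnj (?e l \<xi>) = ?e (k - l) \<xi>\<close>)
      qed
      finally show ?thesis .
    qed
    then have "complex_of_real (LINT \<xi>|lborel. (cmod (P \<xi>))\<^sup>2)
        = (LINT \<xi>|lborel. (\<Sum>k\<in>K. \<Sum>l\<in>K. cnj (c k) * c l * (indicator {-L..L} \<xi> *\<^sub>R ?e (k - l) \<xi>)))"
      by (simp only: integral_complex_of_real[symmetric])
    also have "\<dots> = (\<Sum>k\<in>K. \<Sum>l\<in>K. cnj (c k) * c l * (LINT \<xi>|lborel. indicator {-L..L} \<xi> *\<^sub>R ?e (k - l) \<xi>))"
      using ie by (simp only: Bochner_Integration.integral_sum Bochner_Integration.integrable_sum integrable_mult_right integral_mult_right_zero)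
    also have "\<dots> = (\<Sum>k\<in>K. \<Sum>l\<in>K. if k = l then cnj (c k) * c l * of_real (2 * L) else 0)"
      unfolding integral_cis_periods[OF \<open>\<alpha> > 0\<close> L] by (intro sum.cong refl) simp
    also have "\<dots> = complex_of_real (2 * L * S)"
      using \<open>finite K\<close> unfolding of_real_mult[of "2 * L"] Sc by (simp add: sum_distrib_left mult_ac)
    finally show ?thesis by (simp only: of_real_eq_iff)
  qed
  finally have "S * S \<le> (2 * L * (LINT \<xi>|lborel. (cmod (F \<xi>))\<^sup>2)) * S"
    by (simp add: power2_eq_square mult_ac)
  moreover have "0 \<le> 2 * L * (LINT \<xi>|lborel. (cmod (F \<xi>))\<^sup>2)"
    using L \<open>\<alpha> > 0\<close> by (intro mult_nonneg_nonneg) auto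
  ultimately have "S \<le> 2 * L * (LINT \<xi>|lborel. (cmod (F \<xi>))\<^sup>2)"
    using \<open>S \<ge> 0\<close> by (cases "S = 0") (auto simp: mult_le_cancel_right)
  then show ?thesis by (simp add: S_def)
qed

theorem PW_samples_summable:
  assumes f: "f \<in> PW \<Omega>" and "\<alpha> > 0"
  shows "(\<lambda>k::int. (cmod (f (\<alpha> * of_int k)))\<^sup>2) summable_on UNIV"
proof -
  obtain F where F: "square_integrable F" and band: "\<And>\<xi>. \<xi> \<notin> {-\<Omega>/2..\<Omega>/2} \<Longrightarrow> F \<xi> = 0"
    and inv: "\<And>t. f t = (LINT \<xi>|lborel. F \<xi> * cis (2 * pi * t * \<xi>))"
    using f by (rule PW_inversion) blast
  obtain m :: nat where "\<Omega> / 2 * \<alpha> \<le> real m" using real_arch_simple by blast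
  define L where "L = real m / \<alpha>"
  have m: "\<Omega> / 2 \<le> L" unfolding L_def pos_le_divide_eq[OF \<open>\<alpha> > 0\<close>] by fact
  have "F \<xi> = 0" if "\<xi> \<notin> {-L..L}" for \<xi>
    using that m by (intro band) auto
  from bessel_samples[OF F this \<open>\<alpha> > 0\<close> L_def]
  have "(\<Sum>k\<in>K. (cmod (f (\<alpha> * of_int k)))\<^sup>2) \<le> 2 * L * (LINT \<xi>|lborel. (cmod (F \<xi>))\<^sup>2)" if "finite K" for K :: "int set"
    using that unfolding inv by blast
  then show ?thesis
    by (intro nonneg_bdd_above_summable_on bdd_aboveI2) auto
qed

section \<open>Folding and the toral distance\<close>

lemma fold_real:
  assumes "lam > 0"
  shows "fold_real lam x \<in> {-lam..<lam}" and "\<exists>n::int. x - fold_real lam x = 2 * lam * of_int n"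
proof -
  define n where "n = \<lfloor>(x + lam) / (2 * lam)\<rfloor>"
  have n: "of_int n \<le> (x + lam) / (2 * lam)" "(x + lam) / (2 * lam) < of_int n + 1"
    unfolding n_def by linarith+
  have "\<exists>!y. y \<in> {-lam..<lam} \<and> (\<exists>n::int. x - y = 2 * lam * of_int n)"
  proof (rule ex1I[of _ "x - 2 * lam * of_int n"])
    show "x - 2 * lam * of_int n \<in> {-lam..<lam} \<and> (\<exists>n'::int. x - (x - 2 * lam * of_int n) = 2 * lam * of_int n')"
      using n assms by (auto simp: field_simps)
    fix y assume "y \<in> {-lam..<lam} \<and> (\<exists>n::int. x - y = 2 * lam * of_int n)"
    then obtain k :: int where y: "-lam \<le> y" "y < lam" and k: "x - y = 2 * lam * of_int k" by auto
    have "of_int k \<le> (x + lam) / (2 * lam)" "(x + lam) / (2 * lam) < of_int k + 1"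
      using y k assms by (auto simp: field_simps)
    then have "n = k" unfolding n_def by linarith
    then show "y = x - 2 * lam * of_int n" using k by simp
  qed
  from theI'[OF this] show "fold_real lam x \<in> {-lam..<lam}" "\<exists>n::int. x - fold_real lam x = 2 * lam * of_int n"
    unfolding fold_real_def by auto
qed

text \<open>
  Folding moves \<open>x\<close> either not at all or by at least \<open>2 lam\<close>, and in the second case \<open>\<bar>x\<bar>\<close> is at least \<open>lam\<close>, which bounds
  the folded value.
\<close>

lemma abs_fold_real_le:
  assumes "lam > 0"
  shows "\<bar>fold_real lam x\<bar> \<le> \<bar>x\<bar>"
proof -
  obtain n :: int where n: "x - fold_real lam x = 2 * lam * of_int n" using fold_real(2)[OF assms] by blast
  have r: "-lam \<le> fold_real lam x" "fold_real lam x < lam" using fold_real(1)[OF assms, of x] by auto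
  show ?thesis
  proof (cases "n = 0")
    case True then show ?thesis using n by simp
  next
    case False
    then have "1 \<le> \<bar>real_of_int n\<bar>" by linarith
    then have "2 * lam * 1 \<le> 2 * lam * \<bar>real_of_int n\<bar>" using assms by (intro mult_left_mono) auto
    then have "2 * lam \<le> \<bar>x - fold_real lam x\<bar>" using assms unfolding n by (simp add: abs_mult)
    then show ?thesis using r by linarith
  qed
qed

lemma cmod_fold_complex_le: "lam > 0 \<Longrightarrow> cmod (fold_complex lam z) \<le> cmod z"
  unfolding cmod_def fold_complex_def
  by (simp add: add_mono abs_fold_real_le flip: abs_le_square_iff)

theorem folded_sampling_in_ell2_mod:
  assumes "f \<in> PW \<Omega>" and "lam > 0" and "\<alpha> > 0"
  shows "folded_sampling lam \<alpha> f \<in> ell2_mod lam"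
proof -
  have "(\<lambda>k. (cmod (folded_sampling lam \<alpha> f k))\<^sup>2) summable_on UNIV"
    by (rule summable_on_comparison_test[OF PW_samples_summable[OF assms(1,3)]])
      (auto simp: folded_sampling_def intro!: power_mono cmod_fold_complex_le assms)
  then show ?thesis
    using fold_real(1)[OF \<open>lam > 0\<close>]
    by (auto simp: ell2_mod_def folded_sampling_def fold_complex_def)
qed

lemma toral_dist_nonneg: "0 \<le> toral_dist lam z w"
  unfolding toral_dist_def by (rule cINF_greatest) auto

text \<open>
  Folding changes \<open>z\<close> and \<open>w\<close> by elements of the lattice \<open>2 lam (\<int> + \<i> \<int>)\<close>, which the infimum in the
  toral distance absorbs.
\<close>

lemma toral_dist_fold_le:
  assumes "lam > 0"
  shows "toral_dist lam (fold_complex lam z) (fold_complex lam w) \<le> cmod (w - z - of_real (2 * lam * of_int n))"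
proof -
  obtain p1 :: int where p1: "Re z - fold_real lam (Re z) = 2 * lam * of_int p1" using fold_real(2)[OF assms] by blast
  obtain q1 :: int where q1: "Im z - fold_real lam (Im z) = 2 * lam * of_int q1" using fold_real(2)[OF assms] by blast
  obtain p2 :: int where p2: "Re w - fold_real lam (Re w) = 2 * lam * of_int p2" using fold_real(2)[OF assms] by blast
  obtain q2 :: int where q2: "Im w - fold_real lam (Im w) = 2 * lam * of_int q2" using fold_real(2)[OF assms] by blast
  define p q where "p = p2 - p1 - n" and "q = q2 - q1"
  have "toral_dist lam (fold_complex lam z) (fold_complex lam w)
     \<le> cmod (fold_complex lam z - fold_complex lam w - 2 * of_real lam * Complex (of_int p) (of_int q))"
    unfolding toral_dist_def
    by (rule cINF_lower2[of _ _ "(p, q)"]) (auto intro!: bdd_belowI2[of _ 0])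
  also have "fold_complex lam z - fold_complex lam w - 2 * of_real lam * Complex (of_int p) (of_int q)
     = - (w - z - of_real (2 * lam * of_int n))"
  proof (rule complex_eqI)
    show "Re (fold_complex lam z - fold_complex lam w - 2 * of_real lam * Complex (of_int p) (of_int q))
      = Re (- (w - z - of_real (2 * lam * of_int n)))"
      using p1 p2 by (simp add: fold_complex_def p_def algebra_simps)
    show "Im (fold_complex lam z - fold_complex lam w - 2 * of_real lam * Complex (of_int p) (of_int q))
      = Im (- (w - z - of_real (2 * lam * of_int n)))"
      using q1 q2 by (simp add: fold_complex_def q_def algebra_simps)
  qed
  finally show ?thesis by (simp only: norm_minus_cancel)
qed

section \<open>A rapidly decaying band-limited interpolating kernel\<close>

text \<open>
  A substitute for ``the transform of \<open>u\<close> is supported in \<open>[-B, B]\<close>'' that makes sense for merely bounded \<open>u\<close>, such as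
  the constant \<open>1\<close>: the transform of \<open>u\<close> with a Gaussian weight is at most the transform of the
  weight itself, shifted to the ends of the band. In this form the property passes to products with sinc
  functions, which also preserve the normalisation \<open>\<bar>u\<bar> \<le> 1\<close>.
\<close>

definition gaussian_band_limited :: "real \<Rightarrow> (real \<Rightarrow> complex) \<Rightarrow> bool" where
  "gaussian_band_limited B u \<longleftrightarrow> u \<in> borel_measurable borel \<and> (\<forall>t. cmod (u t) \<le> 1) \<and>
     (\<forall>\<epsilon>>0. \<forall>\<xi>. \<bar>\<xi>\<bar> \<ge> B \<longrightarrow>
        cmod (fourier_integral (\<lambda>t. complex_of_real (exp (- (\<epsilon> * t)\<^sup>2 / 2)) * u t) \<xi>)
          \<le> 2 * pi / \<epsilon> * std_normal_density (2 * pi * (\<bar>\<xi>\<bar> - B) / \<epsilon>))"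

lemma std_normal_density_antimono:
  assumes "0 \<le> x" and "x \<le> y"
  shows "std_normal_density y \<le> std_normal_density x"
  unfolding std_normal_density_def using assms
  by (intro mult_left_mono) (auto intro: power_mono)

lemma integrable_gaussian:
  assumes "\<epsilon> > 0"
  shows "integrable lborel (\<lambda>t. complex_of_real (exp (- (\<epsilon> * t)\<^sup>2 / 2)))"
  using fourier_gaussian[OF assms, of 0] by (simp add: has_bochner_integral_iff)

lemma integrable_gaussian_mult:
  assumes "\<epsilon> > 0" and [measurable]: "u \<in> borel_measurable borel" and "\<And>t. cmod (u t) \<le> 1"
  shows "integrable lborel (\<lambda>t. complex_of_real (exp (- (\<epsilon> * t)\<^sup>2 / 2)) * u t)"
proof (rule Bochner_Integration.integrable_bound[OF integrable_gaussian[OF assms(1)]])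
  show "AE t in lborel. cmod (complex_of_real (exp (- (\<epsilon> * t)\<^sup>2 / 2)) * u t) \<le> cmod (complex_of_real (exp (- (\<epsilon> * t)\<^sup>2 / 2)))"
    by (rule AE_I2) (simp add: norm_mult mult_left_le assms(3))
qed measurable

lemma gaussian_band_limited_one: "gaussian_band_limited 0 (\<lambda>_. 1)"
proof -
  have "cmod (fourier_integral (\<lambda>t. complex_of_real (exp (- (\<epsilon> * t)\<^sup>2 / 2)) * 1) \<xi>)
      \<le> 2 * pi / \<epsilon> * std_normal_density (2 * pi * (\<bar>\<xi>\<bar> - 0) / \<epsilon>)" if "\<epsilon> > 0" for \<epsilon> \<xi>
  proof -
    have "fourier_integral (\<lambda>t. complex_of_real (exp (- (\<epsilon> * t)\<^sup>2 / 2)) * 1) \<xi>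
        = (LINT t|lborel. complex_of_real (exp (- (\<epsilon> * t)\<^sup>2 / 2)) * cis (2 * pi * (- \<xi>) * t))"
      unfolding fourier_integral_cis by (intro Bochner_Integration.integral_cong) (simp_all add: mult_ac)
    also have "\<dots> = complex_of_real (2 * pi / \<epsilon> * std_normal_density (2 * pi * (- \<xi>) / \<epsilon>))"
      using fourier_gaussian[OF that, of "- \<xi>"] unfolding has_bochner_integral_iff by blast
    also have "std_normal_density (2 * pi * (- \<xi>) / \<epsilon>) = std_normal_density (2 * pi * (\<bar>\<xi>\<bar> - 0) / \<epsilon>)"
      by (simp add: std_normal_density_def power_mult_distrib power_divide)
    finally show ?thesis using that by (simp add: norm_mult norm_divide)
  qed
  then show ?thesis unfolding gaussian_band_limited_def by auto
qed

lemma sinc_eq_integral: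
  "complex_of_real (sinc (2 * pi * b * t)) = (LINT y|lborel. (indicator {-1..1} y / 2) * cis (2 * pi * b * t * y))"
proof -
  define x where "x = 2 * pi * b * t"
  have "complex_of_real (sinc x) = (LINT y|lborel. indicator {-1..1} y *\<^sub>R cis (x * y)) / 2"
    using integral_cis_symmetric_interval[of 1 x] by simp
  also have "\<dots> = (LINT y|lborel. (indicator {-1..1} y *\<^sub>R cis (x * y)) / 2)"
    by (rule integral_divide_zero[symmetric])
  also have "\<dots> = (LINT y|lborel. (indicator {-1..1} y / 2) * cis (x * y))"
    by (intro Bochner_Integration.integral_cong) (simp_all add: indicator_def)
  finally show ?thesis unfolding x_def .
qed

lemma abs_sinc_le_1: "\<bar>sinc x\<bar> \<le> 1"
  using abs_sin_x_le_abs_x[of x] by (simp add: divide_le_eq)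

lemma abs_sinc_le_inverse: "\<bar>sinc x\<bar> \<le> 1 / \<bar>x\<bar>" if "x \<noteq> 0"
  using that by (simp add: divide_right_mono)

text \<open>
  Multiplication by \<open>sinc (2 pi b t)\<close> averages the transform over its shifts by at most \<open>b\<close>, and the bound is
  monotone in the distance from the band.
\<close>

lemma gaussian_band_limited_mult_sinc:
  assumes u: "gaussian_band_limited B u" and "b > 0"
  shows "gaussian_band_limited (B + b) (\<lambda>t. u t * complex_of_real (sinc (2 * pi * b * t)))"
proof -
  have [measurable]: "u \<in> borel_measurable borel" and u1: "\<And>t. cmod (u t) \<le> 1"
    and uB: "\<And>\<epsilon> \<xi>. \<epsilon> > 0 \<Longrightarrow> \<bar>\<xi>\<bar> \<ge> B \<Longrightarrow> cmod (fourier_integral (\<lambda>t. complex_of_real (exp (- (\<epsilon> * t)\<^sup>2 / 2)) * u t) \<xi>)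
          \<le> 2 * pi / \<epsilon> * std_normal_density (2 * pi * (\<bar>\<xi>\<bar> - B) / \<epsilon>)"
    using u unfolding gaussian_band_limited_def by blast+
  let ?v = "\<lambda>t. u t * complex_of_real (sinc (2 * pi * b * t))"
  have "?v \<in> borel_measurable borel" by measurable
  moreover have "cmod (?v t) \<le> 1" for t
    unfolding norm_mult norm_of_real by (intro mult_le_one u1 abs_sinc_le_1) auto
  moreover have "cmod (fourier_integral (\<lambda>t. complex_of_real (exp (- (\<epsilon> * t)\<^sup>2 / 2)) * ?v t) \<xi>)
          \<le> 2 * pi / \<epsilon> * std_normal_density (2 * pi * (\<bar>\<xi>\<bar> - (B + b)) / \<epsilon>)"
    if "\<epsilon> > 0" and \<xi>: "\<bar>\<xi>\<bar> \<ge> B + b" for \<epsilon> \<xi>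
  proof -
    define g where "g = (\<lambda>t. complex_of_real (exp (- (\<epsilon> * t)\<^sup>2 / 2)) * u t)"
    have ig: "integrable lborel g"
      unfolding g_def by (intro integrable_gaussian_mult that u1) measurable
    define G where "G = (\<lambda>t. g t * cis (- (2 * pi * t * \<xi>)))"
    have iG: "integrable lborel G" unfolding G_def by (intro integrable_mult_cis ig) measurable
    define w where "w = (\<lambda>y::real. indicator {-1..1} y / 2 :: complex)"
    have iw: "integrable lborel w"
      using integrable_indicator_mult[OF square_integrable_indicator, of "-1" 1 "-1" 1]
      unfolding w_def by (simp add: indicator_inter_arith[symmetric])
    let ?D = "2 * pi / \<epsilon> * std_normal_density (2 * pi * (\<bar>\<xi>\<bar> - (B + b)) / \<epsilon>)"
    have "fourier_integral (\<lambda>t. complex_of_real (exp (- (\<epsilon> * t)\<^sup>2 / 2)) * ?v t) \<xi>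
        = (LINT t|lborel. G t * (LINT y|lborel. w y * cis (2 * pi * b * t * y)))"
      unfolding fourier_integral_cis sinc_eq_integral w_def G_def g_def by (simp only: mult_ac)
    also have "\<dots> = (LINT y|lborel. w y * (LINT t|lborel. G t * cis (2 * pi * b * t * y)))"
      by (rule integral_swap_kernel[OF iG iw, symmetric]) auto
    also have "\<dots> = (LINT y|lborel. w y * fourier_integral g (\<xi> - b * y))"
      unfolding fourier_integral_cis G_def mult.assoc cis_mult
      by (simp add: algebra_simps)
    finally have eq: "fourier_integral (\<lambda>t. complex_of_real (exp (- (\<epsilon> * t)\<^sup>2 / 2)) * ?v t) \<xi>
        = (LINT y|lborel. w y * fourier_integral g (\<xi> - b * y))" .
    have le: "cmod (w y * fourier_integral g (\<xi> - b * y)) \<le> cmod (w y) * ?D" for y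
    proof (cases "y \<in> {-1..1}")
      case True
      have "\<bar>b * y\<bar> \<le> b * 1"
        unfolding abs_mult using True \<open>b > 0\<close> by (intro mult_mono) auto
      then have le: "\<bar>\<xi>\<bar> - (B + b) \<le> \<bar>\<xi> - b * y\<bar> - B" by linarith
      have "cmod (fourier_integral g (\<xi> - b * y)) \<le> 2 * pi / \<epsilon> * std_normal_density (2 * pi * (\<bar>\<xi> - b * y\<bar> - B) / \<epsilon>)"
        unfolding g_def using le \<xi> by (intro uB that) linarith
      also have "\<dots> \<le> ?D"
        using le \<xi> \<open>\<epsilon> > 0\<close>
        by (intro mult_left_mono std_normal_density_antimono divide_right_mono) auto
      finally show ?thesis unfolding norm_mult by (intro mult_left_mono) auto
    qed (simp add: w_def)
    have "cmod (LINT y|lborel. w y * fourier_integral g (\<xi> - b * y)) \<le> (LINT y|lborel. cmod (w y) * ?D)"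
    proof (rule Bochner_Integration.integral_norm_bound_integral)
      show iwD: "integrable lborel (\<lambda>y. cmod (w y) * ?D)" using iw by simp
      note [measurable] = borel_measurable_fourier_integral[of g] borel_measurable_integrable[OF ig] borel_measurable_integrable[OF iw]
      show "integrable lborel (\<lambda>y. w y * fourier_integral g (\<xi> - b * y))"
      proof (rule Bochner_Integration.integrable_bound[OF iwD])
        show "AE y in lborel. cmod (w y * fourier_integral g (\<xi> - b * y)) \<le> norm (cmod (w y) * ?D)"
          by (intro AE_I2 order_trans[OF le]) (simp only: real_norm_def abs_ge_self)
      qed measurable
    qed (rule le)
    also have "(LINT y|lborel. cmod (w y) * ?D) = ?D"
    proof -
      have "cmod (w y) = indicator {-1..1} y / 2" for y by (simp add: w_def indicator_def)
      then have "(LINT y|lborel. cmod (w y)) = (LINT y::real|lborel. indicator {-1..1} y / 2)" by (simp only:)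
      also have "\<dots> = 1" by simp
      finally have "(LINT y|lborel. cmod (w y)) = 1" .
      then show ?thesis by simp
    qed
    finally show ?thesis unfolding eq .
  qed
  ultimately show ?thesis unfolding gaussian_band_limited_def by blast
qed

text \<open>
  For integrable \<open>u\<close> the Gaussian weight can be removed. At a distance \<open>d > 0\<close> from the band the bound tends to \<open>0\<close>, by
  \<open>exp (- s) \<le> 1 / s\<close>.
\<close>

lemma fourier_integral_eq_0_of_gaussian_band_limited:
  assumes u: "gaussian_band_limited B u" and iu: "integrable lborel u" and "\<bar>\<xi>\<bar> > B"
  shows "fourier_integral u \<xi> = 0"
proof -
  have [measurable]: "u \<in> borel_measurable borel" using iu by auto
  have uB: "\<And>\<epsilon> \<xi>. \<epsilon> > 0 \<Longrightarrow> \<bar>\<xi>\<bar> \<ge> B \<Longrightarrow> cmod (fourier_integral (\<lambda>t. complex_of_real (exp (- (\<epsilon> * t)\<^sup>2 / 2)) * u t) \<xi>)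
          \<le> 2 * pi / \<epsilon> * std_normal_density (2 * pi * (\<bar>\<xi>\<bar> - B) / \<epsilon>)"
    using u unfolding gaussian_band_limited_def by blast
  define d where "d = \<bar>\<xi>\<bar> - B"
  have "d > 0" using assms by (simp add: d_def)
  have e0: "(\<lambda>i. 1 / real (Suc i)) \<longlonglongrightarrow> 0" by (intro LIMSEQ_Suc lim_inverse_n')
  let ?g = "\<lambda>i t. complex_of_real (exp (- (1 / real (Suc i) * t)\<^sup>2 / 2)) * u t"
  have lim: "(\<lambda>i. fourier_integral (?g i) \<xi>) \<longlonglongrightarrow> fourier_integral u \<xi>"
    unfolding fourier_integral_cis
  proof (rule integral_dominated_convergence[where w="\<lambda>t. cmod (u t)"])
    show "AE t in lborel. (\<lambda>i. ?g i t * cis (- (2 * pi * t * \<xi>))) \<longlonglongrightarrow> u t * cis (- (2 * pi * t * \<xi>))"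
    proof (rule AE_I2)
      fix t
      have "(\<lambda>i. ?g i t * cis (- (2 * pi * t * \<xi>))) \<longlonglongrightarrow> complex_of_real (exp (- (0 * t)\<^sup>2 / 2)) * u t * cis (- (2 * pi * t * \<xi>))"
        using e0 by (intro tendsto_intros) auto
      then show "(\<lambda>i. ?g i t * cis (- (2 * pi * t * \<xi>))) \<longlonglongrightarrow> u t * cis (- (2 * pi * t * \<xi>))" by simp
    qed
    show "AE t in lborel. cmod (?g i t * cis (- (2 * pi * t * \<xi>))) \<le> cmod (u t)" for i
      by (rule AE_I2) (simp add: norm_mult mult_left_le_one_le)
    show "integrable lborel (\<lambda>t. cmod (u t))" using iu by simp
  qed measurable
  have bound: "cmod (fourier_integral (?g i) \<xi>) \<le> 1 / (pi * d\<^sup>2) * (1 / real (Suc i))" for i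
  proof -
    define x where "x = real (Suc i)"
    have "x > 0" by (simp add: x_def)
    define z where "z = 2 * pi * d * x"
    have "z > 0" using \<open>d > 0\<close> \<open>x > 0\<close> by (simp add: z_def)
    have "cmod (fourier_integral (?g i) \<xi>) \<le> 2 * pi / (1 / x) * std_normal_density (2 * pi * d / (1 / x))"
      unfolding x_def d_def using assms(3) by (intro uB) auto
    also have "\<dots> = 2 * pi * x * std_normal_density z" by (simp add: z_def)
    also have "std_normal_density z \<le> exp (- z\<^sup>2 / 2)"
      unfolding std_normal_density_def using pi_ge_two by (intro mult_left_le_one_le) auto
    also have "exp (- z\<^sup>2 / 2) = inverse (exp (z\<^sup>2 / 2))" by (simp add: exp_minus)
    also have "\<dots> \<le> inverse (z\<^sup>2 / 2)"
    proof (rule le_imp_inverse_le)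
      show "z\<^sup>2 / 2 \<le> exp (z\<^sup>2 / 2)" using exp_ge_add_one_self[of "z\<^sup>2 / 2"] by linarith
    qed (use \<open>z > 0\<close> in simp)
    also have "2 * pi * x * inverse (z\<^sup>2 / 2) = 1 / (pi * d\<^sup>2) * (1 / x)"
      using \<open>d > 0\<close> \<open>x > 0\<close> unfolding z_def by (simp add: power2_eq_square field_simps)
    finally show ?thesis using \<open>x > 0\<close> unfolding x_def by (simp add: mult_left_mono)
  qed
  have "(\<lambda>i. fourier_integral (?g i) \<xi>) \<longlonglongrightarrow> 0"
  proof (rule Lim_null_comparison[OF always_eventually[OF allI[OF bound]]])
    show "(\<lambda>i. 1 / (pi * d\<^sup>2) * (1 / real (Suc i))) \<longlonglongrightarrow> 0"
      by (rule tendsto_mult_right_zero[OF e0])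
  qed
  with lim show ?thesis by (rule LIMSEQ_unique)
qed

text \<open>
  Integrability keeps the transform a plain integral, so that translation and linear combination are immediate, and
  \<open>tame_in_PW\<close> places such functions in the Paley--Wiener space.
\<close>

definition tame_band_limited :: "real \<Rightarrow> (real \<Rightarrow> complex) \<Rightarrow> bool" where
  "tame_band_limited \<Omega> u \<longleftrightarrow> tame u \<and> continuous_on UNIV u \<and>
     (\<forall>\<xi>. \<xi> \<notin> {-\<Omega>/2..\<Omega>/2} \<longrightarrow> fourier_integral u \<xi> = 0)"

lemma tame_if_continuous:
  assumes "continuous_on UNIV u" and "integrable lborel u" and "\<And>t. cmod (u t) \<le> B"
  shows "tame u"
  using assms unfolding tame_def by (auto simp: continuous_on_eq_continuous_at)

lemma tame_band_limited_zero: "tame_band_limited \<Omega> (\<lambda>_. 0)"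
  unfolding tame_band_limited_def
  by (auto intro!: tame_if_continuous[of _ 0] simp: fourier_integral_def)

lemma tame_band_limited_add:
  assumes u: "tame_band_limited \<Omega> u" and v: "tame_band_limited \<Omega> v"
  shows "tame_band_limited \<Omega> (\<lambda>t. u t + v t)"
proof -
  have iu: "integrable lborel u" and iv: "integrable lborel v"
    using u v by (auto simp: tame_band_limited_def tame_def)
  obtain A B where AB: "\<And>t. cmod (u t) \<le> A" "\<And>t. cmod (v t) \<le> B"
    using u v unfolding tame_band_limited_def tame_def by blast
  have cont: "continuous_on UNIV (\<lambda>t. u t + v t)"
    using u v unfolding tame_band_limited_def by (intro continuous_on_add) auto
  have "tame (\<lambda>t. u t + v t)"
    by (rule tame_if_continuous[OF cont Bochner_Integration.integrable_add[OF iu iv], of "A + B"])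
       (intro norm_triangle_mono AB)
  then show ?thesis
    using u v cont unfolding tame_band_limited_def by (simp add: fourier_integral_add[OF iu iv])
qed

lemma tame_band_limited_scale_translate:
  assumes u: "tame_band_limited \<Omega> u"
  shows "tame_band_limited \<Omega> (\<lambda>t. a * u (t - s))"
proof -
  have iu: "integrable lborel u" using u by (auto simp: tame_band_limited_def tame_def)
  obtain A where A: "\<And>t. cmod (u t) \<le> A"
    using u unfolding tame_band_limited_def tame_def by blast
  have cont: "continuous_on UNIV (\<lambda>t. a * u (t - s))"
  proof (rule continuous_on_mult[OF continuous_on_const])
    show "continuous_on UNIV (\<lambda>t. u (t - s))"
    proof (rule continuous_on_compose2[of UNIV u])
      show "continuous_on UNIV u" using u by (simp add: tame_band_limited_def)
      show "continuous_on UNIV (\<lambda>t. t - s)" by (intro continuous_intros)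
    qed simp
  qed
  have "integrable lborel (\<lambda>t. u (- s + 1 * t))"
    by (rule lborel_integrable_real_affine[OF iu]) simp
  then have "tame (\<lambda>t. a * u (t - s))"
    by (intro tame_if_continuous[OF cont, of "cmod a * A"]) (auto simp: norm_mult intro!: mult_left_mono A)
  moreover have "fourier_integral (\<lambda>t. a * u (t - s)) \<xi> = a * cis (- (2 * pi * s * \<xi>)) * fourier_integral u \<xi>" for \<xi>
  proof -
    have "fourier_integral (\<lambda>t. a * u (t - s)) \<xi> = (LINT t|lborel. a * u (s + 1 * t - s) * cis (- (2 * pi * (s + 1 * t) * \<xi>)))"
      unfolding fourier_integral_cis by (subst lborel_integral_real_affine[where c=1 and t=s]) auto
    also have "\<dots> = (LINT t|lborel. (a * cis (- (2 * pi * s * \<xi>))) * (u t * cis (- (2 * pi * t * \<xi>))))"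
    proof (intro Bochner_Integration.integral_cong refl)
      fix t
      have "cis (- (2 * pi * (s + 1 * t) * \<xi>)) = cis (- (2 * pi * s * \<xi>)) * cis (- (2 * pi * t * \<xi>))"
        by (simp add: cis_mult algebra_simps)
      then show "a * u (s + 1 * t - s) * cis (- (2 * pi * (s + 1 * t) * \<xi>)) = (a * cis (- (2 * pi * s * \<xi>))) * (u t * cis (- (2 * pi * t * \<xi>)))"
        by simp
    qed
    finally show ?thesis unfolding fourier_integral_cis by simp
  qed
  ultimately show ?thesis
    using u cont unfolding tame_band_limited_def by auto
qed

lemma tame_band_limited_sum_translates:
  assumes "finite J" and "tame_band_limited \<Omega> u"
  shows "tame_band_limited \<Omega> (\<lambda>t. \<Sum>j\<in>J. a j * u (t - s j))"
  using assms(1)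
  by (induction J rule: finite_induct)
     (simp_all add: tame_band_limited_zero tame_band_limited_add tame_band_limited_scale_translate[OF assms(2)])

text \<open>
  The first factor has half-bandwidth \<open>\<Omega>/4\<close> and vanishes at the nonzero multiples of \<open>2 / \<Omega>\<close>. The power spreads another
  half-bandwidth \<open>\<Omega>/4\<close> over \<open>p\<close> equal factors, which buys decay of order \<open>p\<close> without disturbing the zeros.
\<close>

definition sinc_kernel :: "real \<Rightarrow> nat \<Rightarrow> real \<Rightarrow> real" where
  "sinc_kernel \<Omega> p t = sinc (2 * pi * (\<Omega> / 4) * t) * sinc (2 * pi * (\<Omega> / (4 * real p)) * t) ^ p"

lemma gaussian_band_limited_sinc_kernel:
  assumes "\<Omega> > 0" and "p > 0"
  shows "gaussian_band_limited (\<Omega> / 2) (\<lambda>t. complex_of_real (sinc_kernel \<Omega> p t))"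
proof -
  define b where "b = \<Omega> / (4 * real p)"
  have "b > 0" using assms by (simp add: b_def)
  have "gaussian_band_limited (\<Omega> / 4 + real n * b)
      (\<lambda>t. complex_of_real (sinc (2 * pi * (\<Omega> / 4) * t)) * complex_of_real (sinc (2 * pi * b * t)) ^ n)" for n
  proof (induction n)
    case 0
    show ?case
      using gaussian_band_limited_mult_sinc[OF gaussian_band_limited_one, of "\<Omega> / 4"] assms
      by (simp only: mult_1_left power_0 mult_1_right of_nat_0 mult_zero_left add_0 add_0_right)
  next
    case (Suc n)
    have "\<Omega> / 4 + real n * b + b = \<Omega> / 4 + real (Suc n) * b" by (simp add: algebra_simps)
    with gaussian_band_limited_mult_sinc[OF Suc \<open>b > 0\<close>] show ?case
      by (simp only: power_Suc2 mult.assoc)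
  qed
  from this[of p] have "gaussian_band_limited (\<Omega> / 4 + real p * b) (\<lambda>t. complex_of_real (sinc_kernel \<Omega> p t))"
    by (simp only: sinc_kernel_def b_def[symmetric] of_real_mult of_real_power)
  moreover have "\<Omega> / 4 + real p * b = \<Omega> / 2" using assms by (simp add: b_def)
  ultimately show ?thesis by simp
qed

lemma sinc_kernel_le_power: "\<bar>sinc_kernel \<Omega> p t\<bar> \<le> \<bar>sinc (2 * pi * (\<Omega> / (4 * real p)) * t)\<bar> ^ p"
  unfolding sinc_kernel_def abs_mult power_abs
  by (intro mult_left_le_one_le abs_sinc_le_1) auto

lemma sinc_kernel_le_1: "\<bar>sinc_kernel \<Omega> p t\<bar> \<le> 1"
  by (rule order_trans[OF sinc_kernel_le_power]) (intro power_le_one abs_sinc_le_1 abs_ge_zero)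

lemma sinc_kernel_decay:
  assumes "\<Omega> > 0" and "p > 0" and "t \<noteq> 0"
  shows "\<bar>sinc_kernel \<Omega> p t\<bar> \<le> (2 * real p / (pi * \<Omega> * \<bar>t\<bar>)) ^ p"
proof -
  have "\<bar>sinc (2 * pi * (\<Omega> / (4 * real p)) * t)\<bar> \<le> 1 / \<bar>2 * pi * (\<Omega> / (4 * real p)) * t\<bar>"
    using assms by (intro abs_sinc_le_inverse) auto
  also have "\<dots> = 2 * real p / (pi * \<Omega> * \<bar>t\<bar>)"
    using assms by (simp add: abs_mult field_simps)
  finally show ?thesis
    by (intro order_trans[OF sinc_kernel_le_power] power_mono) auto
qed

lemma continuous_sinc_kernel: "continuous_on UNIV (sinc_kernel \<Omega> p)"
  unfolding sinc_kernel_def[abs_def] by (intro continuous_intros)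

lemma sinc_kernel_interpolates:
  assumes "\<Omega> > 0"
  shows "sinc_kernel \<Omega> p (2 / \<Omega> * of_int n) = (if n = 0 then 1 else 0)"
proof -
  have "2 * pi * (\<Omega> / 4) * (2 / \<Omega> * of_int n) = pi * of_int n" using assms by simp
  moreover have "sin (pi * of_int n) = 0" by (simp add: sin_zero_iff_int2 mult.commute)
  ultimately show ?thesis by (simp add: sinc_kernel_def)
qed

lemma integrable_sinc_kernel:
  assumes "\<Omega> > 0" and "p \<ge> 2"
  shows "integrable lborel (sinc_kernel \<Omega> p)"
proof -
  define a where "a = 2 * pi * (\<Omega> / (4 * real p))"
  have "a > 0" using assms by (simp add: a_def)
  have "set_integrable lborel (einterval (-\<infinity>) \<infinity>) (\<lambda>x. inverse (1 + x\<^sup>2))"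
    by (rule integrable_inverse_1_plus_square)
  then have "integrable lborel (\<lambda>x::real. inverse (1 + x\<^sup>2))"
    unfolding set_integrable_def by simp
  from lborel_integrable_real_affine[OF this, of a 0] \<open>a > 0\<close>
  have i: "integrable lborel (\<lambda>t. 2 * inverse (1 + (a * t)\<^sup>2))" by simp
  show ?thesis
  proof (rule Bochner_Integration.integrable_bound[OF i])
    show "AE t in lborel. norm (sinc_kernel \<Omega> p t) \<le> norm (2 * inverse (1 + (a * t)\<^sup>2))"
    proof (rule AE_I2)
      fix t
      have "\<bar>sinc_kernel \<Omega> p t\<bar> \<le> \<bar>sinc (a * t)\<bar> ^ p"
        unfolding a_def by (rule sinc_kernel_le_power)
      also have "\<dots> \<le> \<bar>sinc (a * t)\<bar> ^ 2"
        using assms by (intro power_decreasing abs_sinc_le_1) auto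
      also have "\<dots> \<le> 2 * inverse (1 + (a * t)\<^sup>2)"
      proof -
        define x where "x = a * t"
        have "\<bar>sinc x\<bar>\<^sup>2 * (1 + x\<^sup>2) = \<bar>sinc x\<bar>\<^sup>2 + (sinc x * x)\<^sup>2" by (simp only: power2_abs distrib_left power_mult_distrib mult_1_right)
        also have "sinc x * x = sin x" by simp
        also have "\<bar>sinc x\<bar>\<^sup>2 + (sin x)\<^sup>2 \<le> 1 + 1"
          by (intro add_mono[OF power_le_one[OF abs_ge_zero abs_sinc_le_1]]) (simp add: abs_square_le_1)
        finally show ?thesis
          unfolding x_def[symmetric] by (simp only: pos_le_divide_eq[symmetric] divide_inverse[symmetric] add_pos_nonneg zero_less_one zero_le_power2 one_add_one)
      qed
      finally show "norm (sinc_kernel \<Omega> p t) \<le> norm (2 * inverse (1 + (a * t)\<^sup>2))" by simp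
    qed
    show "sinc_kernel \<Omega> p \<in> borel_measurable lborel"
      using borel_measurable_continuous_onI[OF continuous_sinc_kernel] by simp
  qed
qed

lemma tame_band_limited_sinc_kernel:
  assumes "\<Omega> > 0" and "p \<ge> 2"
  shows "tame_band_limited \<Omega> (\<lambda>t. complex_of_real (sinc_kernel \<Omega> p t))"
proof -
  have i: "integrable lborel (\<lambda>t. complex_of_real (sinc_kernel \<Omega> p t))"
    using integrable_sinc_kernel[OF assms] by simp
  have cont: "continuous_on UNIV (\<lambda>t. complex_of_real (sinc_kernel \<Omega> p t))"
    by (intro continuous_on_of_real continuous_sinc_kernel)
  have "fourier_integral (\<lambda>t. complex_of_real (sinc_kernel \<Omega> p t)) \<xi> = 0" if "\<xi> \<notin> {-\<Omega>/2..\<Omega>/2}" for \<xi>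
  proof (rule fourier_integral_eq_0_of_gaussian_band_limited[OF gaussian_band_limited_sinc_kernel i])
    show "\<Omega> / 2 < \<bar>\<xi>\<bar>" using that by auto
  qed (use assms in auto)
  then show ?thesis
    unfolding tame_band_limited_def
    by (intro conjI cont tame_if_continuous[OF cont i, of 1]) (auto simp: sinc_kernel_le_1)
qed

section \<open>Band-limited functions with nearly lattice-valued samples\<close>

text \<open>
  Dirichlet's simultaneous approximation for several linear forms: two of the \<open>M ^ card J\<close> vectors with entries below \<open>M\<close>
  send the fractional parts of the \<open>card I\<close> forms into the same cell of side \<open>1 / Q\<close>, and their difference is \<open>d\<close>.
\<close>

lemma integer_combination_near_integers:
  fixes x :: "'i \<Rightarrow> 'j \<Rightarrow> real" and Q M :: nat
  assumes "finite I" and "finite J" and "Q > 0" and card: "Q ^ card I < M ^ card J"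
  obtains d :: "'j \<Rightarrow> int" and n :: "'i \<Rightarrow> int"
  where "\<exists>j\<in>J. d j \<noteq> 0" and "\<And>j. j \<in> J \<Longrightarrow> \<bar>d j\<bar> \<le> int M"
    and "\<And>i. i \<in> I \<Longrightarrow> \<bar>(\<Sum>j\<in>J. of_int (d j) * x i j) - of_int (n i)\<bar> \<le> 1 / real Q"
proof -
  define A where "A = J \<rightarrow>\<^sub>E {..<M}"
  define y where "y = (\<lambda>m i. \<Sum>j\<in>J. real (m j) * x i j)"
  define cell where "cell = (\<lambda>m. \<lambda>i\<in>I. nat \<lfloor>real Q * frac (y m i)\<rfloor>)"
  have fr: "0 \<le> real Q * frac t" "real Q * frac t < real Q" for t :: real
    using \<open>Q > 0\<close> by (auto simp: frac_lt_1)
  have "cell ` A \<subseteq> I \<rightarrow>\<^sub>E {..<Q}"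
  proof -
    have "nat \<lfloor>real Q * frac t\<rfloor> < Q" for t :: real
      using fr[of t] by linarith
    then show ?thesis by (auto simp: cell_def)
  qed
  then have "card (cell ` A) \<le> card (I \<rightarrow>\<^sub>E {..<Q})"
    by (intro card_mono finite_PiE) (simp_all add: assms)
  also have "\<dots> < card A"
    unfolding A_def using assms by (simp add: card_PiE)
  finally have "\<not> inj_on cell A" by (rule pigeonhole)
  then obtain m m' where m: "m \<in> A" "m' \<in> A" "m \<noteq> m'" and eq: "cell m = cell m'"
    unfolding inj_on_def by blast
  show ?thesis
  proof (rule that)
    show "\<exists>j\<in>J. int (m j) - int (m' j) \<noteq> 0"
    proof (rule ccontr)
      assume "\<not> ?thesis"
      then have "m = m'" using m unfolding A_def by (intro PiE_ext) auto
      with \<open>m \<noteq> m'\<close> show False ..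
    qed
    show "\<bar>int (m j) - int (m' j)\<bar> \<le> int M" if "j \<in> J" for j
    proof -
      have "m j < M" "m' j < M" using m that unfolding A_def by (auto simp: PiE_iff)
      then show ?thesis by linarith
    qed
    show "\<bar>(\<Sum>j\<in>J. of_int (int (m j) - int (m' j)) * x i j) - of_int (\<lfloor>y m i\<rfloor> - \<lfloor>y m' i\<rfloor>)\<bar> \<le> 1 / real Q"
      if "i \<in> I" for i
    proof -
      have "nat \<lfloor>real Q * frac (y m i)\<rfloor> = nat \<lfloor>real Q * frac (y m' i)\<rfloor>"
        using fun_cong[OF eq, of i] that by (simp add: cell_def)
      then have "\<lfloor>real Q * frac (y m i)\<rfloor> = \<lfloor>real Q * frac (y m' i)\<rfloor>"
        using fr by (simp add: eq_nat_nat_iff)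
      then have "\<bar>real Q * frac (y m i) - real Q * frac (y m' i)\<bar> \<le> 1" by linarith
      then have "real Q * \<bar>frac (y m i) - frac (y m' i)\<bar> \<le> 1"
        using \<open>Q > 0\<close> by (simp add: abs_mult flip: right_diff_distrib)
      then have "\<bar>frac (y m i) - frac (y m' i)\<bar> \<le> 1 / real Q"
        using \<open>Q > 0\<close> by (simp add: field_simps)
      moreover have "(\<Sum>j\<in>J. of_int (int (m j) - int (m' j)) * x i j) - of_int (\<lfloor>y m i\<rfloor> - \<lfloor>y m' i\<rfloor>)
          = frac (y m i) - frac (y m' i)"
        by (simp add: frac_def y_def left_diff_distrib sum_subtractf)
      ultimately show ?thesis by simp
    qed
  qed
qed

lemma summable_inverse_squares_int: "(\<lambda>k::int. inverse ((of_int k)\<^sup>2 :: real)) summable_on UNIV"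
proof -
  have nat: "(\<lambda>n::nat. inverse ((real n)\<^sup>2)) summable_on UNIV"
    using inverse_power_summable[of 2, where 'a=real]
    by (intro norm_summable_imp_summable_on) simp
  have "(\<lambda>k::int. inverse ((of_int k)\<^sup>2 :: real)) summable_on (range int)"
    using nat by (subst summable_on_reindex) (auto simp: o_def inj_on_def)
  moreover have "(\<lambda>k::int. inverse ((of_int k)\<^sup>2 :: real)) summable_on ((\<lambda>n. - int n) ` {1..})"
    using summable_on_subset_banach[OF nat, of "{1..}"]
    by (subst summable_on_reindex) (auto simp: o_def inj_on_def)
  ultimately have "(\<lambda>k::int. inverse ((of_int k)\<^sup>2 :: real)) summable_on (range int \<union> (\<lambda>n. - int n) ` {1..})"
    by (rule summable_on_Un_disjoint) auto
  moreover have "range int \<union> (\<lambda>n. - int n) ` {1..} = UNIV"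
  proof -
    have "k \<in> range int \<union> (\<lambda>n. - int n) ` {1..}" for k :: int
    proof (cases "k \<ge> 0")
      case True
      then have "k = int (nat k)" by simp
      then show ?thesis by blast
    next
      case False
      then have "k = - int (nat (- k))" "nat (- k) \<in> {1..}" by auto
      then show ?thesis by blast
    qed
    then show ?thesis by blast
  qed
  ultimately show ?thesis by simp
qed

text \<open>
  The translates of the kernel are placed at \<open>\<beta>, \<dots>, N \<beta>\<close>. Inside the window \<open>I\<close> of sample indices the samples
  are close to the lattice by simultaneous approximation; outside it every sample point is at a distance of at least
  \<open>\<alpha> \<bar>k\<bar> / 2\<close> from the centres of all translates, and the decay of the kernel outweighs the coefficients.
\<close>

theorem nearly_lattice_valued_function:
  assumes "\<Omega> > 0" and "lam > 0" and "\<alpha> > 0" and "\<delta> > 0"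
  obtains h :: "real \<Rightarrow> complex" and n :: "int \<Rightarrow> int" and b :: "int \<Rightarrow> real" and t0 :: real
  where "tame_band_limited \<Omega> h" and "\<And>t. h t \<in> \<real>" and "cmod (h t0) \<ge> 1"
    and "b summable_on UNIV" and "(\<Sum>\<^sub>\<infinity>k. b k) < \<delta>\<^sup>2"
    and "\<And>k. (cmod (h (\<alpha> * of_int k) - of_real (2 * lam * of_int (n k))))\<^sup>2 \<le> b k"
proof -
  define \<beta> where "\<beta> = 2 / \<Omega>"
  have "\<beta> > 0" using assms by (simp add: \<beta>_def)
  obtain C :: nat where C: "2 * \<beta> / \<alpha> < real C" using reals_Archimedean2 by blast
  then have Cab: "2 * \<beta> \<le> real C * \<alpha>" and "C \<ge> 1"
  proof -
    show "2 * \<beta> \<le> real C * \<alpha>" using C \<open>\<alpha> > 0\<close> by (simp add: field_simps)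
    have "0 < 2 * \<beta> / \<alpha>" using \<open>\<beta> > 0\<close> \<open>\<alpha> > 0\<close> by simp
    with C have "0 < real C" by linarith
    then show "C \<ge> 1" by simp
  qed
  \<comment> \<open>The coefficients are at most \<open>N ^ (2 * C + 2)\<close> and there are \<open>N\<close> terms. The remaining two powers of \<open>\<bar>k\<bar>\<close>
      give one factor \<open>1 / N\<close> and one factor \<open>1 / \<bar>k\<bar>\<close>, which makes the tail square-summable.\<close>
  define p where "p = 2 * C + 5"
  \<comment> \<open>The constant of \<open>sinc_kernel_decay\<close> at distance \<open>\<alpha> \<bar>k\<bar> / 2\<close>.\<close>
  define A where "A = 4 * real p / (pi * \<Omega> * \<alpha>)"
  have "A > 0" using assms by (simp add: A_def p_def)
  define S where "S = (\<Sum>\<^sub>\<infinity>k::int. inverse ((of_int k)\<^sup>2 :: real))"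
  have "S \<ge> 0" unfolding S_def by (rule infsum_nonneg) simp
  \<comment> \<open>The total squared error turns out to be at most \<open>D / N\<close>.\<close>
  define D where "D = 4 * lam\<^sup>2 * (2 * real C + 1) + (A ^ p)\<^sup>2 * S"
  have "D \<ge> 0" unfolding D_def using \<open>S \<ge> 0\<close> by (intro add_nonneg_nonneg mult_nonneg_nonneg) auto
  obtain N0 :: nat where "D / \<delta>\<^sup>2 < real N0" using reals_Archimedean2 by blast
  \<comment> \<open>\<open>N \<ge> 2\<close> makes powers of \<open>N\<close> strictly increasing in the exponent, which the count of cells needs.\<close>
  define N where "N = N0 + 2"
  have "N \<ge> 2" and DN: "D / real N < \<delta>\<^sup>2"
  proof -
    show "N \<ge> 2" by (simp add: N_def)
    have "D / \<delta>\<^sup>2 < real N" using \<open>D / \<delta>\<^sup>2 < real N0\<close> by (simp add: N_def)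
    then show "D / real N < \<delta>\<^sup>2" using \<open>\<delta> > 0\<close> \<open>N \<ge> 2\<close> by (simp add: field_simps)
  qed
  define I where "I = {- int (C * N)..int (C * N)}"
  define J where "J = {1..N}"
  define M where "M = N ^ (2 * C + 2)"
  define \<phi> where "\<phi> = sinc_kernel \<Omega> p"
  have cardI: "card I = 2 * C * N + 1" by (simp add: I_def nat_add_distrib nat_mult_distrib)
  have cardJ: "card J = N" by (simp add: J_def)
  have card: "N ^ card I < M ^ card J"
    unfolding cardI cardJ M_def power_mult[symmetric]
    using \<open>N \<ge> 2\<close> by (intro power_strict_increasing) (auto simp: algebra_simps)
  have fin: "finite I" "finite J" and "N > 0" using \<open>N \<ge> 2\<close> by (auto simp: I_def J_def)
  obtain d :: "nat \<Rightarrow> int" and n :: "int \<Rightarrow> int"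
    where d0: "\<exists>j\<in>J. d j \<noteq> 0" and dM: "\<And>j. j \<in> J \<Longrightarrow> \<bar>d j\<bar> \<le> int M"
      and near: "\<And>i. i \<in> I \<Longrightarrow> \<bar>(\<Sum>j\<in>J. of_int (d j) * (\<phi> (\<alpha> * of_int i - \<beta> * real j) / (2 * lam))) - of_int (n i)\<bar> \<le> 1 / real N"
    by (rule integer_combination_near_integers[OF fin \<open>N > 0\<close> card,
          where x = "\<lambda>i j. \<phi> (\<alpha> * of_int i - \<beta> * real j) / (2 * lam)"]) (rule that)
  define r where "r = (\<lambda>t. \<Sum>j\<in>J. of_int (d j) * \<phi> (t - \<beta> * real j))"
  define h where "h = (\<lambda>t. \<Sum>j\<in>J. complex_of_real (of_int (d j)) * complex_of_real (\<phi> (t - \<beta> * real j)))"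
  have hr: "h t = complex_of_real (r t)" for t by (simp add: h_def r_def)
  have band: "tame_band_limited \<Omega> h"
    unfolding h_def \<phi>_def
    by (rule tame_band_limited_sum_translates[OF _ tame_band_limited_sinc_kernel, where J=J])
      (use assms in \<open>auto simp: J_def p_def\<close>)
  obtain j0 where j0: "j0 \<in> J" "d j0 \<noteq> 0" using d0 by blast
  have "r (\<beta> * real j0) = of_int (d j0)"
  proof -
    have "\<phi> (\<beta> * real j0 - \<beta> * real j) = (if j = j0 then 1 else 0)" for j
      using sinc_kernel_interpolates[OF \<open>\<Omega> > 0\<close>, of p "int j0 - int j"]
      by (auto simp: \<phi>_def \<beta>_def right_diff_distrib)
    then have "r (\<beta> * real j0) = (\<Sum>j\<in>J. if j = j0 then of_int (d j) else 0)"
      unfolding r_def by (intro sum.cong) auto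
    then show ?thesis using j0 by (simp add: J_def)
  qed
  then have "cmod (h (\<beta> * real j0)) = \<bar>of_int (d j0)\<bar>" unfolding hr by simp
  also have "\<dots> \<ge> 1" using j0(2) by linarith
  finally have big: "cmod (h (\<beta> * real j0)) \<ge> 1" .
  \<comment> \<open>Outside the window the samples are compared with the lattice point \<open>0\<close>.\<close>
  define n' where "n' = (\<lambda>k. if k \<in> I then n k else 0)"
  define b where "b = (\<lambda>k::int. (if k \<in> I then (2 * lam / real N)\<^sup>2 else 0) + (A ^ p / real N)\<^sup>2 * inverse ((of_int k)\<^sup>2))"
  have window: "\<bar>r (\<alpha> * of_int k) - 2 * lam * of_int (n k)\<bar> \<le> 2 * lam / real N" if "k \<in> I" for k
  proof -
    have "r (\<alpha> * of_int k) - 2 * lam * of_int (n k)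
      = 2 * lam * ((\<Sum>j\<in>J. of_int (d j) * (\<phi> (\<alpha> * of_int k - \<beta> * real j) / (2 * lam))) - of_int (n k))"
      unfolding r_def right_diff_distrib sum_distrib_left using \<open>lam > 0\<close> by simp
    also have "\<bar>\<dots>\<bar> \<le> 2 * lam * (1 / real N)"
      using near[OF that] \<open>lam > 0\<close> unfolding abs_mult by (intro mult_mono) auto
    finally show ?thesis by simp
  qed
  have tail: "\<bar>r (\<alpha> * of_int k)\<bar> \<le> A ^ p / real N * inverse \<bar>of_int k\<bar>" if "k \<notin> I" for k
  proof -
    define K where "K = \<bar>real_of_int k\<bar>"
    have "int (C * N) < \<bar>k\<bar>" using that unfolding I_def by auto
    then have "real_of_int (int (C * N)) < real_of_int \<bar>k\<bar>" by (simp only: of_int_less_iff)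
    then have CNK: "real C * real N < K" by (simp add: K_def)
    have "1 * real N \<le> real C * real N" using \<open>C \<ge> 1\<close> by (intro mult_right_mono) auto
    with CNK have NK: "real N \<le> K" by linarith
    have "K > 0" "real N > 0" using NK \<open>N \<ge> 2\<close> by auto
    have "\<bar>of_int (d j) * \<phi> (\<alpha> * of_int k - \<beta> * real j)\<bar> \<le> real M * (A / K) ^ p" if "j \<in> J" for j
    proof -
      define s where "s = \<alpha> * of_int k - \<beta> * real j"
      have "\<beta> * real j \<le> \<beta> * real N" using that \<open>\<beta> > 0\<close> by (simp add: J_def)
      also have "2 * (\<beta> * real N) \<le> \<alpha> * K"
      proof -
        have "2 * \<beta> * real N \<le> real C * \<alpha> * real N" using Cab by (intro mult_right_mono) auto
        also have "\<dots> = \<alpha> * (real C * real N)" by simp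
        also have "\<dots> \<le> \<alpha> * K" using CNK \<open>\<alpha> > 0\<close> by (intro mult_left_mono) auto
        finally show ?thesis by simp
      qed
      moreover have "\<bar>\<alpha> * of_int k\<bar> = \<alpha> * K" using \<open>\<alpha> > 0\<close> by (simp add: K_def abs_mult)
      moreover have "0 \<le> \<beta> * real j" using \<open>\<beta> > 0\<close> by simp
      ultimately have s: "\<alpha> * K / 2 \<le> \<bar>s\<bar>" unfolding s_def by linarith
      have "0 < \<alpha> * K / 2" using \<open>\<alpha> > 0\<close> \<open>K > 0\<close> by simp
      with s have "s \<noteq> 0" by auto
      have "\<bar>\<phi> s\<bar> \<le> (2 * real p / (pi * \<Omega> * \<bar>s\<bar>)) ^ p"
        unfolding \<phi>_def using \<open>s \<noteq> 0\<close> \<open>\<Omega> > 0\<close> by (intro sinc_kernel_decay) (auto simp: p_def)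
      also have "\<dots> \<le> (A / K) ^ p"
      proof (rule power_mono)
        have "2 * real p / (pi * \<Omega> * \<bar>s\<bar>) \<le> 2 * real p / (pi * \<Omega> * (\<alpha> * K / 2))"
          using s \<open>0 < \<alpha> * K / 2\<close> \<open>\<Omega> > 0\<close> by (intro divide_left_mono mult_left_mono) auto
        also have "\<dots> = A / K" using assms \<open>K > 0\<close> by (simp add: A_def field_simps)
        finally show "2 * real p / (pi * \<Omega> * \<bar>s\<bar>) \<le> A / K" .
      qed (use \<open>\<Omega> > 0\<close> in simp)
      finally have "\<bar>\<phi> s\<bar> \<le> (A / K) ^ p" .
      moreover have "real_of_int \<bar>d j\<bar> \<le> real_of_int (int M)" using dM[OF that] by (simp only: of_int_le_iff)
      then have "\<bar>real_of_int (d j)\<bar> \<le> real M" by simp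
      ultimately show ?thesis unfolding s_def[symmetric] abs_mult by (intro mult_mono) auto
    qed
    then have "(\<Sum>j\<in>J. \<bar>of_int (d j) * \<phi> (\<alpha> * of_int k - \<beta> * real j)\<bar>) \<le> real (card J) * (real M * (A / K) ^ p)"
      by (rule sum_bounded_above)
    then have "\<bar>r (\<alpha> * of_int k)\<bar> \<le> real N * (real M * (A / K) ^ p)"
      unfolding r_def cardJ by (rule order_trans[OF sum_abs])
    also have "\<dots> = A ^ p * (real N ^ (2 * C + 3) / K ^ (2 * C + 5))"
      by (simp add: M_def p_def power_divide power_add eval_nat_numeral)
    also have "\<dots> = A ^ p / real N * (real N ^ (2 * C + 4) / K ^ (2 * C + 4)) * inverse K"
      using \<open>real N > 0\<close> \<open>K > 0\<close> by (simp add: power_add eval_nat_numeral field_simps)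
    also have "\<dots> \<le> A ^ p / real N * 1 * inverse K"
      using \<open>A > 0\<close> \<open>real N > 0\<close> \<open>K > 0\<close> NK
      by (intro mult_right_mono mult_left_mono) (auto simp: divide_le_eq_1 intro!: power_mono)
    finally show ?thesis by (simp add: K_def)
  qed
  have bound: "(cmod (h (\<alpha> * of_int k) - of_real (2 * lam * of_int (n' k))))\<^sup>2 \<le> b k" for k
  proof -
    have "h (\<alpha> * of_int k) - of_real (2 * lam * of_int (n' k)) = complex_of_real (r (\<alpha> * of_int k) - 2 * lam * of_int (n' k))"
      by (simp add: hr)
    then have eq: "(cmod (h (\<alpha> * of_int k) - of_real (2 * lam * of_int (n' k))))\<^sup>2 = \<bar>r (\<alpha> * of_int k) - 2 * lam * of_int (n' k)\<bar>\<^sup>2"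
      by (simp only: norm_of_real)
    show ?thesis
    proof (cases "k \<in> I")
      case True
      then have "\<bar>r (\<alpha> * of_int k) - 2 * lam * of_int (n' k)\<bar>\<^sup>2 \<le> (2 * lam / real N)\<^sup>2"
        using window[OF True] by (intro power_mono) (auto simp: n'_def)
      also have "\<dots> \<le> b k" using True by (simp add: b_def)
      finally show ?thesis unfolding eq .
    next
      case False
      then have "\<bar>r (\<alpha> * of_int k) - 2 * lam * of_int (n' k)\<bar>\<^sup>2 \<le> (A ^ p / real N * inverse \<bar>of_int k\<bar>)\<^sup>2"
        using tail[OF False] by (intro power_mono) (auto simp: n'_def)
      also have "\<dots> = b k" using False by (simp only: b_def if_False add_0 power_mult_distrib power_inverse power2_abs)
      finally show ?thesis unfolding eq .
    qed
  qed
  have s1: "((\<lambda>k. if k \<in> I then (2 * lam / real N)\<^sup>2 else 0) has_sum (real (card I) * (2 * lam / real N)\<^sup>2)) UNIV"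
  proof -
    have "((\<lambda>k. (2 * lam / real N)\<^sup>2) has_sum (real (card I) * (2 * lam / real N)\<^sup>2)) I"
      by (rule has_sum_finiteI) (simp_all add: I_def)
    then show ?thesis by (rule iffD1[OF has_sum_cong_neutral, rotated -1]) auto
  qed
  have s2: "((\<lambda>k::int. (A ^ p / real N)\<^sup>2 * inverse ((of_int k)\<^sup>2)) has_sum ((A ^ p / real N)\<^sup>2 * S)) UNIV"
    unfolding S_def by (intro has_sum_cmult_right has_sum_infsum summable_inverse_squares_int)
  have hs: "(b has_sum (real (card I) * (2 * lam / real N)\<^sup>2 + (A ^ p / real N)\<^sup>2 * S)) UNIV"
    unfolding b_def by (rule has_sum_add[OF s1 s2])
  have "real (card I) * (2 * lam / real N)\<^sup>2 + (A ^ p / real N)\<^sup>2 * S \<le> D / real N"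
  proof -
    have N1: "1 \<le> real N" using \<open>N \<ge> 2\<close> by simp
    have "real (card I) \<le> (2 * real C + 1) * real N"
      unfolding cardI using N1 by (simp add: algebra_simps)
    then have "real (card I) * (2 * lam / real N)\<^sup>2 \<le> (2 * real C + 1) * real N * (2 * lam / real N)\<^sup>2"
      by (intro mult_right_mono) auto
    also have "\<dots> = 4 * lam\<^sup>2 * (2 * real C + 1) / real N"
      using N1 by (simp add: power2_eq_square field_simps)
    finally have 1: "real (card I) * (2 * lam / real N)\<^sup>2 \<le> 4 * lam\<^sup>2 * (2 * real C + 1) / real N" .
    have "(A ^ p / real N)\<^sup>2 * S = (A ^ p)\<^sup>2 * S / real N * (1 / real N)"
      by (simp add: power2_eq_square)
    also have "\<dots> \<le> (A ^ p)\<^sup>2 * S / real N * 1"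
      using N1 \<open>S \<ge> 0\<close> by (intro mult_left_mono) auto
    finally show ?thesis using 1 by (simp add: D_def add_divide_distrib)
  qed
  with DN have "(\<Sum>\<^sub>\<infinity>k. b k) < \<delta>\<^sup>2" unfolding infsumI[OF hs] by linarith
  moreover have "h t \<in> \<real>" for t unfolding hr by simp
  moreover have "b summable_on UNIV" using hs by (rule has_sum_imp_summable)
  ultimately show ?thesis using band big bound by (intro that[of h "\<beta> * real j0" b n'])
qed

section \<open>Instability of folded sampling\<close>

text \<open>
  The values of \<open>f\<close> cancel in \<open>toral_dist_fold_le\<close>, which leaves a condition on \<open>h\<close> only.
\<close>

lemma ell2_mod_dist_perturbation_le:
  assumes "lam > 0" and b: "b summable_on UNIV" 
    and le: "\<And>k. (cmod (h (\<alpha> * of_int k) - of_real (2 * lam * of_int (n k))))\<^sup>2 \<le> b k"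
  shows "ell2_mod_dist lam (folded_sampling lam \<alpha> f) (folded_sampling lam \<alpha> (\<lambda>t. f t + h t)) \<le> sqrt (\<Sum>\<^sub>\<infinity>k. b k)"
proof -
  let ?d = "\<lambda>k. (toral_dist lam (folded_sampling lam \<alpha> f k) (folded_sampling lam \<alpha> (\<lambda>t. f t + h t) k))\<^sup>2"
  have d: "?d k \<le> b k" for k
  proof -
    have "?d k \<le> (cmod (f (\<alpha> * of_int k) + h (\<alpha> * of_int k) - f (\<alpha> * of_int k) - of_real (2 * lam * of_int (n k))))\<^sup>2"
      unfolding folded_sampling_def
      by (intro power_mono toral_dist_fold_le toral_dist_nonneg assms)
    also have "\<dots> \<le> b k" using le by simp
    finally show ?thesis .
  qed
  have "?d summable_on UNIV"
    by (rule summable_on_comparison_test[OF b]) (simp_all add: d)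
  then have "(\<Sum>\<^sub>\<infinity>k. ?d k) \<le> (\<Sum>\<^sub>\<infinity>k. b k)"
    by (rule infsum_mono[OF _ b d])
  then show ?thesis unfolding ell2_mod_dist_def by simp
qed

text \<open>
  The perturbation \<open>g - f\<close> is real, so one statement covers both the complex and the real space.
\<close>

lemma folded_sampling_unstable:
  assumes "\<Omega> > 0" and "lam > 0" and "\<alpha> > 0" and "\<delta> > 0" and f: "f \<in> PW \<Omega>"
  shows "\<exists>g \<in> PW \<Omega>. (\<forall>t. g t - f t \<in> \<real>) \<and>
     ell2_mod_dist lam (folded_sampling lam \<alpha> f) (folded_sampling lam \<alpha> g) < \<delta> \<and>
     L2_norm (\<lambda>t. f t - g t) > sqrt (1 / \<Omega>) / 2"
proof -
  obtain h :: "real \<Rightarrow> complex" and n :: "int \<Rightarrow> int" and b :: "int \<Rightarrow> real" and t0 :: real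
    where h: "tame_band_limited \<Omega> h" and real: "\<And>t. h t \<in> \<real>" and big: "cmod (h t0) \<ge> 1"
    and b: "b summable_on UNIV" "(\<Sum>\<^sub>\<infinity>k. b k) < \<delta>\<^sup>2"
    and le: "\<And>k. (cmod (h (\<alpha> * of_int k) - of_real (2 * lam * of_int (n k))))\<^sup>2 \<le> b k"
    by (rule nearly_lattice_valued_function[OF assms(1-4)]) (rule that)
  have tame: "tame h" and cont: "continuous_on UNIV h"
    and band: "\<And>\<xi>. \<xi> \<notin> {-\<Omega>/2..\<Omega>/2} \<Longrightarrow> fourier_integral h \<xi> = 0"
    using h unfolding tame_band_limited_def by blast+
  define g where "g = (\<lambda>t. f t + h t)"
  have "g \<in> PW \<Omega>" unfolding g_def by (rule PW_add[OF f tame_in_PW[OF tame cont band]])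
  moreover have "g t - f t \<in> \<real>" for t by (simp add: g_def real)
  moreover have "ell2_mod_dist lam (folded_sampling lam \<alpha> f) (folded_sampling lam \<alpha> g) < \<delta>"
  proof -
    have "ell2_mod_dist lam (folded_sampling lam \<alpha> f) (folded_sampling lam \<alpha> g) \<le> sqrt (\<Sum>\<^sub>\<infinity>k. b k)"
      unfolding g_def by (rule ell2_mod_dist_perturbation_le[OF \<open>lam > 0\<close> b(1) le])
    also have "\<dots> < \<delta>" using b(2) \<open>\<delta> > 0\<close> by (intro real_less_lsqrt) auto
    finally show ?thesis .
  qed
  moreover have "L2_norm (\<lambda>t. f t - g t) > sqrt (1 / \<Omega>) / 2"
  proof -
    have "1 \<le> (cmod (h t0))\<^sup>2" using big by simp
    also have "\<dots> \<le> \<Omega> * (LINT t|lborel. (cmod (h t))\<^sup>2)"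
      using \<open>\<Omega> > 0\<close> by (intro band_limited_pointwise_bound[OF tame cont _ band]) auto
    finally have "1 / \<Omega> \<le> (LINT t|lborel. (cmod (h t))\<^sup>2)"
      using \<open>\<Omega> > 0\<close> by (simp add: divide_le_eq mult.commute)
    then have "sqrt (1 / \<Omega>) \<le> L2_norm (\<lambda>t. f t - g t)"
      unfolding L2_norm_def g_def by (simp only: real_sqrt_le_iff) simp
    moreover have "sqrt (1 / \<Omega>) > 0" using \<open>\<Omega> > 0\<close> by simp
    ultimately show ?thesis by linarith
  qed
  ultimately show ?thesis by blast
qed

text \<open>
  A left inverse maps the folded samples of \<open>f\<close> and \<open>g\<close> back to \<open>f\<close> and \<open>g\<close>, so instability at \<open>f\<close> contradicts continuity at
  the image of \<open>f\<close>.
\<close>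

lemma no_continuous_left_inverse:
  assumes "\<forall>f \<in> D. \<exists>\<epsilon>>0. \<forall>\<delta>>0. \<exists>g \<in> D.
     ell2_mod_dist lam (M f) (M g) < \<delta> \<and> L2_norm (\<lambda>t. f t - g t) > \<epsilon>"
  shows "\<not> (\<exists>T. left_inverse_on D M T \<and> (\<exists>a \<in> M ` D. recovery_continuous_at lam (M ` D) T a))"
proof
  assume "\<exists>T. left_inverse_on D M T \<and> (\<exists>a \<in> M ` D. recovery_continuous_at lam (M ` D) T a)"
  then obtain T f where T: "\<And>f. f \<in> D \<Longrightarrow> T (M f) = f" and f: "f \<in> D"
    and cont: "recovery_continuous_at lam (M ` D) T (M f)"
    unfolding left_inverse_on_def by blast
  obtain \<epsilon> where "\<epsilon> > 0" and \<epsilon>: "\<And>\<delta>. \<delta> > 0 \<Longrightarrow> \<exists>g \<in> D.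
     ell2_mod_dist lam (M f) (M g) < \<delta> \<and> L2_norm (\<lambda>t. f t - g t) > \<epsilon>"
    using assms f by blast
  obtain \<delta> where "\<delta> > 0" and \<delta>: "\<And>b. b \<in> M ` D \<Longrightarrow> ell2_mod_dist lam (M f) b < \<delta> \<Longrightarrow> L2_norm (\<lambda>t. T (M f) t - T b t) < \<epsilon>"
    using cont \<open>\<epsilon> > 0\<close> unfolding recovery_continuous_at_def by blast
  obtain g where g: "g \<in> D" "ell2_mod_dist lam (M f) (M g) < \<delta>" "L2_norm (\<lambda>t. f t - g t) > \<epsilon>"
    using \<epsilon>[OF \<open>\<delta> > 0\<close>] by blast
  have "L2_norm (\<lambda>t. f t - g t) < \<epsilon>"
    using \<delta>[of "M g"] g f by (simp add: T)
  with g(3) show False by simp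
qed

theorem theorem2p1:
  fixes \<Omega> lam \<alpha> :: real
  assumes "\<Omega> > 0" and "lam > 0" and "\<alpha> > 0"
  shows "folded_sampling lam \<alpha> \<in> PW \<Omega> \<rightarrow> ell2_mod lam
    \<and> \<not> (\<exists>T. left_inverse_on (PW \<Omega>) (folded_sampling lam \<alpha>) T \<and>
            (\<exists>a \<in> folded_sampling lam \<alpha> ` PW \<Omega>.
               recovery_continuous_at lam (folded_sampling lam \<alpha> ` PW \<Omega>) T a))
    \<and> (\<forall>f \<in> PW \<Omega>. \<exists>\<epsilon>>0. \<forall>\<delta>>0. \<exists>g \<in> PW \<Omega>.
          ell2_mod_dist lam (folded_sampling lam \<alpha> f) (folded_sampling lam \<alpha> g) < \<delta> \<and>
          L2_norm (\<lambda>t. f t - g t) > \<epsilon>)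
    \<and> \<not> (\<exists>T. left_inverse_on (PW_real \<Omega>) (folded_sampling lam \<alpha>) T \<and>
            (\<exists>a \<in> folded_sampling lam \<alpha> ` PW_real \<Omega>.
               recovery_continuous_at lam (folded_sampling lam \<alpha> ` PW_real \<Omega>) T a))
    \<and> (\<forall>f \<in> PW_real \<Omega>. \<exists>\<epsilon>>0. \<forall>\<delta>>0. \<exists>g \<in> PW_real \<Omega>.
          ell2_mod_dist lam (folded_sampling lam \<alpha> f) (folded_sampling lam \<alpha> g) < \<delta> \<and>
          L2_norm (\<lambda>t. f t - g t) > \<epsilon>)"
proof -
  have \<epsilon>: "sqrt (1 / \<Omega>) / 2 > 0" using assms by simp
  have "\<exists>g \<in> PW \<Omega>. ell2_mod_dist lam (folded_sampling lam \<alpha> f) (folded_sampling lam \<alpha> g) < \<delta> \<and>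
          L2_norm (\<lambda>t. f t - g t) > sqrt (1 / \<Omega>) / 2" if "f \<in> PW \<Omega>" "\<delta> > 0" for f \<delta>
    using folded_sampling_unstable[OF assms that(2,1)] by blast
  with \<epsilon> have complex: "\<forall>f \<in> PW \<Omega>. \<exists>\<epsilon>>0. \<forall>\<delta>>0. \<exists>g \<in> PW \<Omega>.
          ell2_mod_dist lam (folded_sampling lam \<alpha> f) (folded_sampling lam \<alpha> g) < \<delta> \<and>
          L2_norm (\<lambda>t. f t - g t) > \<epsilon>" by blast
  have "\<exists>g \<in> PW_real \<Omega>. ell2_mod_dist lam (folded_sampling lam \<alpha> f) (folded_sampling lam \<alpha> g) < \<delta> \<and>
          L2_norm (\<lambda>t. f t - g t) > sqrt (1 / \<Omega>) / 2" if f: "f \<in> PW_real \<Omega>" and "\<delta> > 0" for f \<delta>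
  proof -
    have "f \<in> PW \<Omega>" and fr: "\<And>t. f t \<in> \<real>" using f by (auto simp: PW_real_def)
    then obtain g where g: "g \<in> PW \<Omega>" "\<And>t. g t - f t \<in> \<real>"
      "ell2_mod_dist lam (folded_sampling lam \<alpha> f) (folded_sampling lam \<alpha> g) < \<delta>"
      "L2_norm (\<lambda>t. f t - g t) > sqrt (1 / \<Omega>) / 2"
      using folded_sampling_unstable[OF assms \<open>\<delta> > 0\<close>] by blast
    have "g t \<in> \<real>" for t
      using Reals_add[OF g(2) fr, of t t] by simp
    with g show ?thesis unfolding PW_real_def by blast
  qed
  with \<epsilon> have real: "\<forall>f \<in> PW_real \<Omega>. \<exists>\<epsilon>>0. \<forall>\<delta>>0. \<exists>g \<in> PW_real \<Omega>.
          ell2_mod_dist lam (folded_sampling lam \<alpha> f) (folded_sampling lam \<alpha> g) < \<delta> \<and>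
          L2_norm (\<lambda>t. f t - g t) > \<epsilon>" by blast
  show ?thesis
    using folded_sampling_in_ell2_mod[OF _ assms(2,3)]
      no_continuous_left_inverse[OF complex] no_continuous_left_inverse[OF real] complex real
    by (intro conjI funcsetI)
qed

end
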